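(* Let $r\geq 2$ be an integer and $\alpha\in(0,1)$. For every $\delta>0$ there exists $K>0$ such that, if $t=t(n)$ satisfies $Kn^{2-2/r}\leq t\leq n^{2-\delta}$, then there exists $b=b(n)=O\big(n^{r-1}/t^{r/2-1}\big)$ such that there exists a successful $(t,b)$-strategy for an $\alpha$-$K_r$-factor.
   Context: Budget-constrained random graph process: let $M=\binom{n}{2}$. The edges of $K_n$ on vertex set $[n]$ are put in a uniformly random order $e_1,e_2,\ldots,e_M$. Builder is presented $e_1,\ldots,e_t$ one by one and, as each edge is presented and without knowledge of future edges, must irrevocably decide (possibly using additional randomness) whether to purchase it; she may purchase at most $b$ edges in total. A $(t,b)$-strategy is a rule for these decisions; $B_t$ denotes the graph of purchased edges after time $t$. (Strategies are really sequences of strategies indexed by $n$.) A strategy is successful for a property $\mathcal{P}$ if $B_t$ satisfies $\mathcal{P}$ with probability tending to $1$ as $n\to\infty$. For a graph $F$ and $\alpha\in(0,1)$, a graph $G$ on $n$ vertices contains an $\alpha$-$F$-factor if it contains at least $\alpha n/|V(F)|$ vertex-disjoint copies of $F$. $K_r$ is the complete graph on $r$ vertices. *)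

theory Defs
  imports
    "HOL-Probability.Probability"
    "HOL-Library.Landau_Symbols"
    "HOL-Library.Ramsey"
begin

subsection \<open>Finite simple graphs and factors\<close>

text \<open>A graph is a pair of a vertex set and a set of two-element subsets of it.\<close>

type_synonym 'a graph = "'a set \<times> 'a set set"

abbreviation verts :: "'a graph \<Rightarrow> 'a set" where "verts \<equiv> fst"
abbreviation edges :: "'a graph \<Rightarrow> 'a set set" where "edges \<equiv> snd"

definition complete_ugraph :: "nat \<Rightarrow> nat graph" where
  "complete_ugraph r = ({1..r}, nsets {1..r} 2)"

definition subgraph :: "'a graph \<Rightarrow> 'a graph \<Rightarrow> bool" where
  "subgraph H G \<longleftrightarrow> verts H \<subseteq> verts G \<and> edges H \<subseteq> edges G"

definition isomorphic :: "'a graph \<Rightarrow> 'b graph \<Rightarrow> bool" where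
  "isomorphic F H \<longleftrightarrow>
     (\<exists>f. bij_betw f (verts F) (verts H) \<and> (\<lambda>e. f ` e) ` edges F = edges H)"

definition has_factor :: "real \<Rightarrow> 'b graph \<Rightarrow> 'a graph \<Rightarrow> bool" where
  "has_factor \<alpha> F G \<longleftrightarrow>
     (\<exists>\<C>. finite \<C> \<and> (\<forall>H\<in>\<C>. subgraph H G \<and> isomorphic F H) \<and>
          pairwise (\<lambda>H H'. verts H \<inter> verts H' = {}) \<C> \<and>
          real (card \<C>) \<ge> \<alpha> * real (card (verts G)) / real (card (verts F)))"


subsection \<open>The budget-constrained random graph process\<close>

text \<open>
  A strategy maps the history (the edges presented so far, in order, each with the decision
  taken) and the edge currently presented to the distribution of the purchase decision. Its own
  randomness consists of a fresh draw from this distribution at each step; deterministic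
  strategies are those with values of the form \<open>return_pmf\<close>.
\<close>

type_synonym edge = "nat set"
type_synonym history = "(edge \<times> bool) list"
type_synonym strategy = "history \<Rightarrow> edge \<Rightarrow> bool pmf"

primrec play :: "strategy \<Rightarrow> history \<Rightarrow> edge list \<Rightarrow> history pmf" where
  "play \<sigma> h [] = return_pmf h"
| "play \<sigma> h (e # es) = bind_pmf (\<sigma> h e) (\<lambda>x. play \<sigma> (h @ [(e, x)]) es)"

definition edge_order :: "nat \<Rightarrow> edge list pmf" where
  "edge_order n = pmf_of_set (permutations_of_set (edges (complete_ugraph n)))"

text \<open>If \<open>t\<close> exceeds the number of edges of the complete graph, all edges are presented.\<close>

definition history_pmf :: "nat \<Rightarrow> nat \<Rightarrow> strategy \<Rightarrow> history pmf" where
  "history_pmf n t \<sigma> = bind_pmf (edge_order n) (\<lambda>es. play \<sigma> [] (take t es))"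

definition purchased :: "history \<Rightarrow> edge set" where
  "purchased h = {e. (e, True) \<in> set h}"

definition builder_graph :: "nat \<Rightarrow> nat \<Rightarrow> strategy \<Rightarrow> nat graph pmf" where
  "builder_graph n t \<sigma> = map_pmf (\<lambda>h. ({1..n}, purchased h)) (history_pmf n t \<sigma>)"

text \<open>
  The budget is respected surely, i.e. on every history of positive probability. The presented
  edges are distinct, so the cardinality counts all purchases.
\<close>

definition is_strategy :: "nat \<Rightarrow> nat \<Rightarrow> nat \<Rightarrow> strategy \<Rightarrow> bool" where
  "is_strategy n t b \<sigma> \<longleftrightarrow> (\<forall>h \<in> set_pmf (history_pmf n t \<sigma>). card (purchased h) \<le> b)"

definition successful :: "(nat \<Rightarrow> nat) \<Rightarrow> (nat \<Rightarrow> strategy) \<Rightarrow> (nat graph \<Rightarrow> bool) \<Rightarrow> bool" where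
  "successful t \<sigma> P \<longleftrightarrow>
     (\<lambda>n. measure_pmf.prob (builder_graph n (t n) (\<sigma> n)) {G. P G}) \<longlonglongrightarrow> 1"

end

theory Submission
  imports Defs
begin

text \<open>
  Split the vertices into blocks of length \<open>N\<close> of order \<open>(n\<^sup>2 / t)\<close> to the power \<open>r / 2\<close> and buy
  every edge inside a block while the budget lasts. The expected number of such edges is of
  order \<open>t N / n\<close>, which is the required budget, and a moment generating function bound shows that
  the budget is not exceeded. Each block sees a random graph whose density is a large constant
  times \<open>N\<close> to the power \<open>- 2 / r\<close>, that is, above the threshold for an almost \<open>K\<^sub>r\<close>-factor: by Janson's
  inequality a fixed set of \<open>(1 - \<alpha>) n\<close> vertices contains no \<open>K\<^sub>r\<close> inside a block with probability
  at most \<open>exp (- 2 n)\<close>, so a union bound excludes all such sets, and a maximal family of disjoint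
  copies covers more than \<open>\<alpha> n\<close> vertices. The upper bound on \<open>t\<close> makes \<open>N\<close> tend to infinity, which
  renders the correlation term in Janson's inequality negligible. Janson's inequality is applied in
  the binomial model of density below \<open>t\<close> over twice the number of edges and transferred to the first
  \<open>t\<close> edges of a random order by monotonicity.
\<close>

subsection \<open>Janson's inequality for binomial random subsets\<close>

text \<open>The expectation of \<open>f\<close> at the random subset of \<open>E\<close> that
  contains each element independently with probability \<open>p\<close>. As a finite sum it allows
  induction on \<open>E\<close> in place of product measures.\<close>

definition bexp :: "real \<Rightarrow> 'a set \<Rightarrow> ('a set \<Rightarrow> real) \<Rightarrow> real" where
  "bexp p E f = (\<Sum>S\<in>Pow E. p ^ card S * (1 - p) ^ card (E - S) * f S)"

lemma bexp_empty [simp]: "bexp p {} f = f {}"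
  by (simp add: bexp_def)

text \<open>Condition on whether \<open>e\<close> is chosen. This recursion drives the inductions on
  the ground set below.\<close>

lemma bexp_insert:
  assumes "finite E" "e \<notin> E"
  shows "bexp p (insert e E) f = p * bexp p E (\<lambda>S. f (insert e S)) + (1 - p) * bexp p E f"
proof -
  let ?w = "\<lambda>D S. p ^ card S * (1 - p) ^ card (D - S) * f S"
  have fin: "finite S" if "S \<in> Pow E" for S
    using that assms by (auto intro: finite_subset)
  have "inj_on (insert e) (Pow E)"
    using assms(2) by (auto simp: inj_on_def)
  moreover have "Pow E \<inter> insert e ` Pow E = {}"
    using assms(2) by auto
  ultimately have "bexp p (insert e E) f
      = (\<Sum>S\<in>Pow E. ?w (insert e E) S) + (\<Sum>S\<in>Pow E. ?w (insert e E) (insert e S))"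
    using assms(1) by (simp add: bexp_def Pow_insert sum.union_disjoint sum.reindex)
  also have "(\<Sum>S\<in>Pow E. ?w (insert e E) S) = (1 - p) * bexp p E f"
    unfolding bexp_def sum_distrib_left
  proof (rule sum.cong)
    fix S assume "S \<in> Pow E"
    then have "insert e E - S = insert e (E - S)" using assms(2) by auto
    then show "?w (insert e E) S = (1 - p) * (p ^ card S * (1 - p) ^ card (E - S) * f S)"
      using assms by simp
  qed simp
  also have "(\<Sum>S\<in>Pow E. ?w (insert e E) (insert e S)) = p * bexp p E (\<lambda>S. f (insert e S))"
    unfolding bexp_def sum_distrib_left
  proof (rule sum.cong)
    fix S assume S: "S \<in> Pow E"
    then have "insert e E - insert e S = E - S" "e \<notin> S" using assms(2) by auto
    then show "?w (insert e E) (insert e S)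
        = p * (p ^ card S * (1 - p) ^ card (E - S) * f (insert e S))"
      using fin[OF S] by simp
  qed simp
  finally show ?thesis by simp
qed

lemma bexp_cong: "(\<And>S. S \<subseteq> E \<Longrightarrow> f S = g S) \<Longrightarrow> bexp p E f = bexp p E g"
  unfolding bexp_def by (intro sum.cong) auto

lemma bexp_mono:
  assumes "0 \<le> p" "p \<le> 1" "\<And>S. S \<subseteq> E \<Longrightarrow> f S \<le> g S"
  shows "bexp p E f \<le> bexp p E g"
  unfolding bexp_def using assms by (intro sum_mono mult_left_mono) auto

lemma bexp_add: "bexp p E (\<lambda>S. f S + g S) = bexp p E f + bexp p E g"
  by (simp add: bexp_def algebra_simps sum.distrib)

lemma bexp_diff: "bexp p E (\<lambda>S. f S - g S) = bexp p E f - bexp p E g"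
  by (simp add: bexp_def algebra_simps sum_subtractf)

lemma bexp_cmult: "bexp p E (\<lambda>S. c * f S) = c * bexp p E f"
  by (simp add: bexp_def sum_distrib_left algebra_simps)

lemma bexp_sum: "bexp p E (\<lambda>S. \<Sum>i\<in>I. f i S) = (\<Sum>i\<in>I. bexp p E (f i))"
  unfolding bexp_def sum_distrib_left by (rule sum.swap)

lemma bexp_one: "finite E \<Longrightarrow> bexp p E (\<lambda>S. 1) = 1"
  by (induction E rule: finite_induct) (simp_all add: bexp_insert)

lemma bexp_nonneg:
  assumes "0 \<le> p" "p \<le> 1" "\<And>S. S \<subseteq> E \<Longrightarrow> 0 \<le> f S"
  shows "0 \<le> bexp p E f"
  unfolding bexp_def using assms by (intro sum_nonneg mult_nonneg_nonneg) auto

text \<open>Induction on \<open>E\<close>, conditioning on one element \<open>e\<close>. The product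
  of the two mixtures differs from the mixture of the products by \<open>p * (1 - p)\<close> times
  the drops of \<open>f\<close> and of \<open>g\<close> when \<open>e\<close> is added; both drops
  are nonnegative since both functions decrease.\<close>

lemma bexp_Harris:
  assumes "finite E" "0 \<le> p" "p \<le> 1"
    and "\<And>S T. S \<subseteq> T \<Longrightarrow> T \<subseteq> E \<Longrightarrow> f T \<le> f S"
    and "\<And>S T. S \<subseteq> T \<Longrightarrow> T \<subseteq> E \<Longrightarrow> g T \<le> g S"
  shows "bexp p E f * bexp p E g \<le> bexp p E (\<lambda>S. f S * g S)"
  using assms(1,4,5)
proof (induction E arbitrary: f g rule: finite_induct)
  case empty
  then show ?case by simp
next
  case (insert e E)
  let ?f1 = "\<lambda>S. f (insert e S)" and ?g1 = "\<lambda>S. g (insert e S)"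
  have f1: "?f1 T \<le> ?f1 S" and g1: "?g1 T \<le> ?g1 S" and f0: "f T \<le> f S" and g0: "g T \<le> g S"
    if "S \<subseteq> T" "T \<subseteq> E" for S T
    using that by (auto intro!: insert.prems)
  have a: "bexp p E ?f1 \<le> bexp p E f" "bexp p E ?g1 \<le> bexp p E g"
    using assms(2,3) by (auto intro!: bexp_mono insert.prems)
  have "bexp p (insert e E) f * bexp p (insert e E) g
      = p * (bexp p E ?f1 * bexp p E ?g1) + (1 - p) * (bexp p E f * bexp p E g)
        - p * (1 - p) * ((bexp p E f - bexp p E ?f1) * (bexp p E g - bexp p E ?g1))"
    by (simp add: bexp_insert[OF insert.hyps] algebra_simps)
  also have "\<dots> \<le> p * (bexp p E ?f1 * bexp p E ?g1) + (1 - p) * (bexp p E f * bexp p E g)"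
    using a assms(2,3) by simp
  also have "\<dots> \<le> p * bexp p E (\<lambda>S. ?f1 S * ?g1 S) + (1 - p) * bexp p E (\<lambda>S. f S * g S)"
    using insert.IH[of ?f1 ?g1, OF f1 g1] insert.IH[of f g, OF f0 g0] assms(2,3)
    by (intro add_mono mult_left_mono) auto
  also have "\<dots> = bexp p (insert e E) (\<lambda>S. f S * g S)"
    by (simp add: bexp_insert[OF insert.hyps])
  finally show ?case .
qed

text \<open>Peel off the elements of \<open>A\<close> one at a time: without \<open>e\<close> the
  indicator vanishes, and with \<open>e\<close> a factor \<open>p\<close> appears while the rest of
  the integrand does not see \<open>e\<close>.\<close>

lemma bexp_indep:
  assumes "finite E" "A \<subseteq> E" and "\<And>S e. e \<in> A \<Longrightarrow> g (insert e S) = g S"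
  shows "bexp p E (\<lambda>S. of_bool (A \<subseteq> S) * g S) = p ^ card A * bexp p E g"
proof -
  have "finite A" using assms finite_subset by blast
  then show ?thesis using assms(2,3)
  proof (induction A rule: finite_induct)
    case empty
    then show ?case by simp
  next
    case (insert e A)
    let ?h = "\<lambda>S. of_bool (A \<subseteq> S) * g S" and ?E = "E - {e}"
    have E: "E = insert e ?E" "finite ?E" "e \<notin> ?E" using insert.prems assms(1) by auto
    have g: "g (insert e S) = g S" for S using insert.prems by simp
    have h: "?h (insert e S) = ?h S" for S
      unfolding g using insert.hyps by (simp add: subset_insert)
    have eA: "insert e A \<subseteq> insert e S \<longleftrightarrow> A \<subseteq> S" for S
      using insert.hyps by auto
    have "bexp p E (\<lambda>S. of_bool (insert e A \<subseteq> S) * g S)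
        = p * bexp p ?E (\<lambda>S. of_bool (insert e A \<subseteq> insert e S) * g (insert e S))
          + (1 - p) * bexp p ?E (\<lambda>S. of_bool (insert e A \<subseteq> S) * g S)"
      using bexp_insert[OF E(2,3), of p "\<lambda>S. of_bool (insert e A \<subseteq> S) * g S"]
      unfolding E(1)[symmetric] .
    also have "bexp p ?E (\<lambda>S. of_bool (insert e A \<subseteq> S) * g S) = bexp p ?E (\<lambda>S. 0)"
      by (rule bexp_cong) auto
    also have "p * bexp p ?E (\<lambda>S. of_bool (insert e A \<subseteq> insert e S) * g (insert e S))
          + (1 - p) * bexp p ?E (\<lambda>S. 0) = p * bexp p ?E ?h"
      unfolding eA g by (simp add: bexp_def)
    \<comment> \<open>The integrand ignores \<open>e\<close>, so putting \<open>e\<close> back into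
      the ground set leaves the expectation unchanged.\<close>
    also have "bexp p ?E ?h = bexp p E ?h"
      by (subst (2) E(1), subst bexp_insert[OF E(2,3)], subst h) (simp add: algebra_simps)
    finally show ?case using insert by simp
  qed
qed

lemma bexp_superset:
  assumes "finite E" "A \<subseteq> E"
  shows "bexp p E (\<lambda>S. of_bool (A \<subseteq> S)) = p ^ card A"
  using bexp_indep[of E A "\<lambda>_. 1" p] assms by (simp add: bexp_one)

text \<open>
  The Boppana--Spencer argument: the event of index \<open>i\<close> is independent of the avoidance \<open>D0\<close> of the sets
  disjoint from \<open>A i\<close>, and Harris' inequality bounds its overlap with the remaining sets. The
  correlation sum runs over ordered pairs, hence is twice the usual one.
\<close>

theorem Janson_inequality:
  assumes "finite E" "0 \<le> p" "p \<le> 1" "finite I" "\<And>i. i \<in> I \<Longrightarrow> A i \<subseteq> E"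
  shows "bexp p E (\<lambda>S. of_bool (\<forall>i\<in>I. \<not> A i \<subseteq> S))
    \<le> exp (- (\<Sum>i\<in>I. p ^ card (A i))
           + (\<Sum>i\<in>I. \<Sum>j | j \<in> I \<and> j \<noteq> i \<and> A i \<inter> A j \<noteq> {}. p ^ card (A i \<union> A j)))"
  using assms(4,5)
proof (induction I rule: finite_induct)
  case empty
  then show ?case using assms by (simp add: bexp_one)
next
  case (insert i I)
  define near where "near = {j \<in> I. A i \<inter> A j \<noteq> {}}"
  define D where "D S = (of_bool (\<forall>j\<in>I. \<not> A j \<subseteq> S) :: real)" for S
  define D0 where "D0 S = (of_bool (\<forall>j\<in>I - near. \<not> A j \<subseteq> S) :: real)" for S
  define B where "B S = (of_bool (A i \<subseteq> S) :: real)" for S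
  \<comment> \<open>\<open>x\<close> serves as a lower bound for the conditional probability of the
    event of index \<open>i\<close> given that all earlier events fail.\<close>
  define x where "x = p ^ card (A i) - (\<Sum>j\<in>near. p ^ card (A i \<union> A j))"
  have finn: "finite near" "near \<subseteq> I" using insert by (auto simp: near_def)
  have sub: "A j \<subseteq> E" if "j \<in> insert i I" for j using insert.prems that by blast
  have nonneg: "0 \<le> bexp p E D" "0 \<le> bexp p E (\<lambda>S. B S * D S)"
    using assms by (auto intro!: bexp_nonneg simp: D_def B_def)
  have DD0: "bexp p E D \<le> bexp p E D0"
    using assms by (intro bexp_mono) (auto simp: D_def D0_def)
  have ind: "bexp p E (\<lambda>S. B S * D0 S) = p ^ card (A i) * bexp p E D0"
    unfolding B_def
  proof (rule bexp_indep)
    fix S e assume e: "e \<in> A i"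
    have "(A j \<subseteq> insert e S) = (A j \<subseteq> S)" if "j \<in> I - near" for j
      using e that by (auto simp: near_def)
    then show "D0 (insert e S) = D0 S" by (simp add: D0_def)
  qed (use assms sub in auto)
  have har: "bexp p E (\<lambda>S. of_bool (A i \<union> A j \<subseteq> S) * D0 S) \<le> p ^ card (A i \<union> A j) * bexp p E D0"
    if j: "j \<in> I" for j
  proof -
    \<comment> \<open>Containing \<open>A i \<union> A j\<close> is an increasing event, so Harris'
      inequality is applied to its complement.\<close>
    let ?f = "\<lambda>S. 1 - of_bool (A i \<union> A j \<subseteq> S) :: real"
    have "bexp p E ?f * bexp p E D0 \<le> bexp p E (\<lambda>S. ?f S * D0 S)"
      using assms by (intro bexp_Harris) (auto simp: D0_def dest: subset_trans)
    moreover have "bexp p E ?f = 1 - p ^ card (A i \<union> A j)"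
      using sub[of i] sub[OF insertI2[OF j]] assms(1)
        bexp_superset[of E "A i \<union> A j" p]
      by (simp only: bexp_diff bexp_one Un_subset_iff insertI1 simp_thms)
    ultimately show ?thesis
      by (simp add: left_diff_distrib bexp_diff bexp_one[OF assms(1)])
  qed
  have "x * bexp p E D0 \<le> bexp p E (\<lambda>S. B S * D0 S)
      - (\<Sum>j\<in>near. bexp p E (\<lambda>S. of_bool (A i \<union> A j \<subseteq> S) * D0 S))"
    unfolding x_def left_diff_distrib ind sum_distrib_right
    using har finn by (intro diff_left_mono sum_mono) auto
  also have "\<dots> = bexp p E (\<lambda>S. B S * D0 S - (\<Sum>j\<in>near. of_bool (A i \<union> A j \<subseteq> S) * D0 S))"
    by (simp add: bexp_diff bexp_sum)
  also have "\<dots> \<le> bexp p E (\<lambda>S. B S * D S)"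
  proof (rule bexp_mono)
    fix S
    show "B S * D0 S - (\<Sum>j\<in>near. of_bool (A i \<union> A j \<subseteq> S) * D0 S) \<le> B S * D S"
    proof (cases "\<exists>j\<in>near. A j \<subseteq> S")
      case True
      then obtain j where j: "j \<in> near" "A j \<subseteq> S" by blast
      \<comment> \<open>One term of the subtracted sum already equals \<open>B S * D0 S\<close>, so
        the left-hand side is at most 0.\<close>
      have "B S * D0 S = of_bool (A i \<union> A j \<subseteq> S) * D0 S" using j by (simp add: B_def)
      also have "\<dots> \<le> (\<Sum>j\<in>near. of_bool (A i \<union> A j \<subseteq> S) * D0 S)"
        using j finn by (intro member_le_sum) (auto simp: D0_def)
      finally show ?thesis by (smt (verit) B_def D_def zero_le_mult_iff of_bool_def)
    next
      case False
      then have "D0 S = D S" by (auto simp: D0_def D_def)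
      moreover have "0 \<le> (\<Sum>j\<in>near. of_bool (A i \<union> A j \<subseteq> S) * D0 S)"
        by (intro sum_nonneg) (simp add: D0_def)
      ultimately show ?thesis by simp
    qed
  qed (use assms in auto)
  finally have key: "x * bexp p E D0 \<le> bexp p E (\<lambda>S. B S * D S)" .
  \<comment> \<open>Passing from \<open>D0\<close> to the smaller \<open>D\<close> needs
    \<open>x\<close> nonnegative; for negative \<open>x\<close> the left-hand side is at most 0
    anyway.\<close>
  have key': "x * bexp p E D \<le> bexp p E (\<lambda>S. B S * D S)"
  proof (cases "x \<ge> 0")
    case True
    then show ?thesis using mult_left_mono[OF DD0, of x] key by simp
  next
    case False
    then show ?thesis using nonneg by (smt (verit) mult_nonneg_nonneg mult_minus_left)
  qed
  have "bexp p E (\<lambda>S. of_bool (\<forall>j\<in>insert i I. \<not> A j \<subseteq> S)) = bexp p E (\<lambda>S. D S - B S * D S)"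
    by (rule bexp_cong) (auto simp: D_def B_def)
  also have "\<dots> \<le> (1 - x) * bexp p E D"
    using key' by (simp add: bexp_diff algebra_simps)
  also have "\<dots> \<le> exp (- x) * bexp p E D"
    using nonneg exp_ge_add_one_self[of "- x"] by (intro mult_right_mono) auto
  also have "\<dots> \<le> exp (- x) * exp (- (\<Sum>i\<in>I. p ^ card (A i))
           + (\<Sum>i\<in>I. \<Sum>j | j \<in> I \<and> j \<noteq> i \<and> A i \<inter> A j \<noteq> {}. p ^ card (A i \<union> A j)))"
    using insert.IH insert.prems unfolding D_def by (intro mult_left_mono) auto
  also have "\<dots> = exp (- (p ^ card (A i) + (\<Sum>i\<in>I. p ^ card (A i)))
           + ((\<Sum>j\<in>near. p ^ card (A i \<union> A j)) +
             (\<Sum>i\<in>I. \<Sum>j | j \<in> I \<and> j \<noteq> i \<and> A i \<inter> A j \<noteq> {}. p ^ card (A i \<union> A j))))"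
    by (simp add: x_def flip: exp_add)
  also have "\<dots> \<le> exp (- (\<Sum>i\<in>insert i I. p ^ card (A i))
           + (\<Sum>k\<in>insert i I. \<Sum>j | j \<in> insert i I \<and> j \<noteq> k \<and> A k \<inter> A j \<noteq> {}. p ^ card (A k \<union> A j)))"
  proof -
    have "near = {j \<in> insert i I. j \<noteq> i \<and> A i \<inter> A j \<noteq> {}}"
      using insert.hyps by (auto simp: near_def)
    moreover have "(\<Sum>k\<in>I. \<Sum>j | j \<in> I \<and> j \<noteq> k \<and> A k \<inter> A j \<noteq> {}. p ^ card (A k \<union> A j))
      \<le> (\<Sum>k\<in>I. \<Sum>j | j \<in> insert i I \<and> j \<noteq> k \<and> A k \<inter> A j \<noteq> {}. p ^ card (A k \<union> A j))"
      using insert.hyps assms by (intro sum_mono sum_mono2) auto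
    ultimately show ?thesis
      using insert.hyps by simp
  qed
  finally show ?case .
qed


subsection \<open>Uniform random subsets and random orders\<close>

lemma bexp_card: "finite E \<Longrightarrow> bexp p E (\<lambda>S. real (card S)) = p * card E"
proof (induction E rule: finite_induct)
  case (insert e E)
  have "bexp p E (\<lambda>S. real (card (insert e S))) = bexp p E (\<lambda>S. real (card S) + 1)"
    using insert.hyps by (intro bexp_cong) (auto simp: card_insert_if finite_subset)
  then show ?case
    using insert by (simp add: bexp_insert bexp_add bexp_one algebra_simps)
qed simp

lemma nsets_ne: "finite E \<Longrightarrow> k \<le> card E \<Longrightarrow> nsets E k \<noteq> {}"
  by (simp add: nsets_eq_empty_iff)

text \<open>An order that begins with \<open>S\<close> is an order of \<open>S\<close> followed by
  an order of its complement, in a unique way.\<close>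

lemma card_permutations_take_eq:
  assumes "finite E" "S \<subseteq> E"
  shows "card {es \<in> permutations_of_set E. set (take (card S) es) = S}
    = fact (card S) * fact (card E - card S)"
proof -
  have finS: "finite S" using assms finite_subset by blast
  let ?f = "\<lambda>(xs, ys). xs @ ys"
  have len: "length xs = card S" if "xs \<in> permutations_of_set S" for xs
    using that by (auto simp: permutations_of_set_def distinct_card)
  have "{es \<in> permutations_of_set E. set (take (card S) es) = S}
      = ?f ` (permutations_of_set S \<times> permutations_of_set (E - S))"
  proof (intro equalityI subsetI)
    fix es assume "es \<in> {es \<in> permutations_of_set E. set (take (card S) es) = S}"
    then have es: "set es = E" "distinct es" "set (take (card S) es) = S"
      by (auto simp: permutations_of_set_def)
    let ?k = "card S"
    have "set (drop ?k es) = E - S"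
      using es set_take_disj_set_drop_if_distinct[OF es(2), of ?k ?k]
      by (metis Diff_cancel Int_Diff Un_Diff Un_empty_left append_take_drop_id inf.commute
          Diff_triv le_refl set_append)
    then have "(take ?k es, drop ?k es) \<in> permutations_of_set S \<times> permutations_of_set (E - S)"
      using es by (auto simp: permutations_of_set_def)
    then show "es \<in> ?f ` (permutations_of_set S \<times> permutations_of_set (E - S))"
      by (intro image_eqI[of _ _ "(take ?k es, drop ?k es)"]) auto
  next
    fix es assume "es \<in> ?f ` (permutations_of_set S \<times> permutations_of_set (E - S))"
    then obtain xs ys where *: "es = xs @ ys" "xs \<in> permutations_of_set S"
      "ys \<in> permutations_of_set (E - S)" by auto
    then show "es \<in> {es \<in> permutations_of_set E. set (take (card S) es) = S}"
      using len[of xs] assms by (auto simp: permutations_of_set_def)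
  qed
  moreover have "inj_on ?f (permutations_of_set S \<times> permutations_of_set (E - S))"
    using len by (auto simp: inj_on_def)
  ultimately show ?thesis
    using assms finS by (simp add: card_image card_cartesian_product card_Diff_subset)
qed

lemma map_pmf_take_permutation:
  assumes "finite E" "k \<le> card E"
  shows "map_pmf (\<lambda>es. set (take k es)) (pmf_of_set (permutations_of_set E)) = pmf_of_set (nsets E k)"
proof (rule pmf_eqI)
  fix S
  let ?P = "permutations_of_set E"
  have P: "?P \<noteq> {}" "finite ?P" using assms by (auto simp: permutations_of_set_empty_iff)
  have N: "nsets E k \<noteq> {}" "finite (nsets E k)"
    using assms by (auto simp: nsets_ne finite_imp_finite_nsets)
  have "pmf (map_pmf (\<lambda>es. set (take k es)) (pmf_of_set ?P)) S
      = card {es \<in> ?P. set (take k es) = S} / card ?P"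
    using P by (simp add: pmf_map measure_pmf_of_set vimage_def Int_def)
  also have "\<dots> = pmf (pmf_of_set (nsets E k)) S"
  proof (cases "S \<in> nsets E k")
    case True
    then have S: "S \<subseteq> E" "card S = k" by (auto simp: nsets_def)
    have "real (card {es \<in> ?P. set (take k es) = S}) = fact k * fact (card E - k)"
      using card_permutations_take_eq[OF assms(1) S(1)] S(2) by simp
    then show ?thesis
      using N True assms by (simp add: card_nsets binomial_fact)
  next
    case False
    have "{es \<in> ?P. set (take k es) = S} = {}"
    proof -
      have "set (take k es) \<in> nsets E k" if "es \<in> ?P" for es
        using that assms
        by (auto simp: permutations_of_set_def nsets_def distinct_card dest: in_set_takeD)
      then show ?thesis using False by blast
    qed
    then show ?thesis using N False by simp
  qed
  finally show "pmf (map_pmf (\<lambda>es. set (take k es)) (pmf_of_set ?P)) S = pmf (pmf_of_set (nsets E k)) S" .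
qed

text \<open>A coupling: both uniform subsets are initial segments of one random order, hence
  nested.\<close>

lemma prob_nsets_antimono:
  assumes "finite E" "k \<le> t" "t \<le> card E" and Q: "\<And>S T. S \<subseteq> T \<Longrightarrow> Q T \<Longrightarrow> Q S"
  shows "measure_pmf.prob (pmf_of_set (nsets E t)) {S. Q S}
    \<le> measure_pmf.prob (pmf_of_set (nsets E k)) {S. Q S}"
proof -
  have k: "k \<le> card E" using assms by simp
  have "Q (set (take k es))" if "Q (set (take t es))" for es
    using Q[OF set_take_subset_set_take[OF assms(2)]] that by blast
  then show ?thesis
    unfolding map_pmf_take_permutation[OF assms(1,3), symmetric]
      map_pmf_take_permutation[OF assms(1) k, symmetric] measure_map_pmf
    by (intro measure_pmf.finite_measure_mono) auto
qed

text \<open>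
  By Markov's inequality a binomial random subset has at most \<open>t\<close> elements with probability at least
  one half, and a smaller uniform subset is only more likely to have a decreasing property.
\<close>

lemma prob_nsets_le_bexp:
  fixes p :: real
  assumes "finite E" "0 < t" "t \<le> card E" "0 \<le> p" "p \<le> 1" "p * card E \<le> t / 2"
    and Q: "\<And>S T. S \<subseteq> T \<Longrightarrow> Q T \<Longrightarrow> Q S"
  shows "measure_pmf.prob (pmf_of_set (nsets E t)) {S. Q S} \<le> 2 * bexp p E (\<lambda>S. of_bool (Q S))"
proof -
  define u where "u k = measure_pmf.prob (pmf_of_set (nsets E k)) {S. Q S}" for k
  define w where "w k = p ^ k * (1 - p) ^ (card E - k)" for k
  have finN: "finite (nsets E k)" for k using assms by (simp add: finite_imp_finite_nsets)
  have w: "p ^ card S * (1 - p) ^ card (E - S) = w (card S)" if "S \<subseteq> E" for S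
    using that assms(1) by (simp add: w_def card_Diff_subset finite_subset)
  \<comment> \<open>\<open>w k\<close> is the binomial probability of each single set of size
    \<open>k\<close>. Regrouped by sets, the sum becomes the expectation of
    \<open>of_bool (Q S) - u t\<close> restricted to sets with at most \<open>t\<close>
    elements.\<close>
  have "0 \<le> (\<Sum>k\<le>t. w k * (card (nsets E k) * (u k - u t)))"
  proof (intro sum_nonneg mult_nonneg_nonneg)
    fix k assume "k \<in> {..t}"
    then show "0 \<le> u k - u t"
      using prob_nsets_antimono[of E k t Q] assms by (simp add: u_def)
  qed (use assms in \<open>auto simp: w_def\<close>)
  also have "\<dots> = (\<Sum>k\<le>t. \<Sum>S\<in>nsets E k. w k * (of_bool (Q S) - u t))"
  proof (rule sum.cong)
    fix k assume "k \<in> {..t}"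
    then have "k \<le> card E" "nsets E k \<noteq> {}" using assms by (simp_all add: nsets_ne)
    then have "u k = card {S \<in> nsets E k. Q S} / card (nsets E k)" "card (nsets E k) > 0"
      using finN by (simp_all add: u_def measure_pmf_of_set Int_def card_gt_0_iff)
    then have "card (nsets E k) * u k = card {S \<in> nsets E k. Q S}"
      by (metis less_numeral_extra(3) mult.commute nonzero_eq_divide_eq of_nat_eq_0_iff)
    also have "\<dots> = (\<Sum>S\<in>nsets E k. of_bool (Q S))"
      using finN by (simp add: of_bool_def sum.If_cases Int_def)
    finally show "w k * (card (nsets E k) * (u k - u t))
        = (\<Sum>S\<in>nsets E k. w k * (of_bool (Q S) - u t))"
      by (simp add: sum_subtractf algebra_simps flip: sum_distrib_left)
  qed simp
  also have "\<dots> = (\<Sum>S\<in>(\<Union>k\<in>{..t}. nsets E k). w (card S) * (of_bool (Q S) - u t))"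
    using finN by (subst sum.UNION_disjoint) (auto simp: nsets_def)
  also have "(\<Union>k\<in>{..t}. nsets E k) = {S \<in> Pow E. card S \<le> t}"
    using assms(1) by (auto simp: nsets_def finite_subset)
  also have "(\<Sum>S\<in>{S \<in> Pow E. card S \<le> t}. w (card S) * (of_bool (Q S) - u t))
      = (\<Sum>S\<in>Pow E. if card S \<le> t then w (card S) * (of_bool (Q S) - u t) else 0)"
    using assms(1) by (intro sum.inter_filter) auto
  also have "\<dots> = bexp p E (\<lambda>S. of_bool (card S \<le> t) * (of_bool (Q S) - u t))"
    unfolding bexp_def by (intro sum.cong) (auto simp: w)
  finally have "u t * bexp p E (\<lambda>S. of_bool (card S \<le> t))
      \<le> bexp p E (\<lambda>S. of_bool (card S \<le> t) * of_bool (Q S))"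
    by (simp only: right_diff_distrib bexp_diff bexp_cmult mult.commute[of _ "u t"])
  also have "\<dots> \<le> bexp p E (\<lambda>S. of_bool (Q S))"
    using assms by (intro bexp_mono) auto
  finally have 1: "u t * bexp p E (\<lambda>S. of_bool (card S \<le> t)) \<le> bexp p E (\<lambda>S. of_bool (Q S))" .
  \<comment> \<open>Markov's inequality in pointwise form: \<open>1 - card S / t\<close> is at most
    the indicator of \<open>card S \<le> t\<close>.\<close>
  have "1 - p * card E / t = bexp p E (\<lambda>S. 1 - (1 / t) * real (card S))"
    unfolding bexp_diff bexp_cmult by (simp add: bexp_one bexp_card assms(1))
  also have "\<dots> \<le> bexp p E (\<lambda>S. of_bool (card S \<le> t))"
    using assms by (intro bexp_mono) (auto simp: of_bool_def field_simps)
  finally have "1 - p * card E / t \<le> bexp p E (\<lambda>S. of_bool (card S \<le> t))" .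
  moreover have "p * card E / t \<le> 1 / 2"
    using assms(2,6) by (simp add: divide_simps)
  ultimately have "1 / 2 \<le> bexp p E (\<lambda>S. of_bool (card S \<le> t))" by linarith
  then have "u t * (1 / 2) \<le> u t * bexp p E (\<lambda>S. of_bool (card S \<le> t))"
    by (intro mult_left_mono) (auto simp: u_def)
  with 1 show ?thesis by (simp add: u_def)
qed

section \<open>Upper tail for the intersection of a uniform subset with a fixed set\<close>

lemma binomial_diff_mult_power_le:
  assumes "a \<le> t" "t \<le> m"
  shows "real ((m - a) choose (t - a)) * real m ^ a \<le> real (m choose t) * real t ^ a"
  using assms(1)
proof (induction a)
  case (Suc a)
  let ?c = "real ((m - Suc a) choose (t - Suc a))"
  have eq: "(m - a) * ((m - Suc a) choose (t - Suc a)) = (t - a) * ((m - a) choose (t - a))"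
    using binomial_absorption[of "t - Suc a" "m - a"] Suc.prems assms(2)
    by (simp add: Suc_diff_Suc)
  have "real (m - a) * (?c * real m) = real (t - a) * real ((m - a) choose (t - a)) * real m"
    by (metis eq mult.assoc of_nat_mult)
  also have "\<dots> = real ((m - a) choose (t - a)) * (real (t - a) * real m)" by simp
  also have "\<dots> \<le> real ((m - a) choose (t - a)) * (real (m - a) * real t)"
  proof (rule mult_left_mono)
    have "real a * real t \<le> real a * real m" using assms(2) by (simp add: mult_left_mono)
    then show "real (t - a) * real m \<le> real (m - a) * real t"
      using Suc.prems assms(2) by (simp add: of_nat_diff algebra_simps)
  qed simp
  also have "\<dots> = real (m - a) * (real ((m - a) choose (t - a)) * real t)" by simp
  finally have "?c * real m \<le> real ((m - a) choose (t - a)) * real t"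
    using Suc.prems assms(2) by simp
  then have "?c * real m * real m ^ a \<le> real ((m - a) choose (t - a)) * real t * real m ^ a"
    by (intro mult_right_mono) auto
  also have "\<dots> = real ((m - a) choose (t - a)) * real m ^ a * real t" by simp
  also have "\<dots> \<le> real (m choose t) * real t ^ a * real t"
    using Suc by (intro mult_right_mono) auto
  finally show ?case by (simp add: mult_ac)
qed simp

text \<open>With \<open>m = card E\<close>, a uniform \<open>t\<close>-set contains \<open>A\<close>
  with probability the product of \<open>(t - i) / (m - i)\<close> over \<open>i < card A\<close>,
  and each factor is at most \<open>t / m\<close>.\<close>

lemma card_nsets_superset_le:
  assumes "finite E" "A \<subseteq> E" "t \<le> card E" "0 < t"
  shows "real (card {S \<in> nsets E t. A \<subseteq> S}) \<le> real (card E choose t) * (real t / card E) ^ card A"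
proof (cases "card A \<le> t")
  case True
  have fA: "finite A" using assms finite_subset by blast
  have "bij_betw (\<lambda>R. A \<union> R) (nsets (E - A) (t - card A)) {S \<in> nsets E t. A \<subseteq> S}"
  proof (rule bij_betwI[where g = "\<lambda>S. S - A"])
    show "(\<lambda>R. A \<union> R) \<in> nsets (E - A) (t - card A) \<rightarrow> {S \<in> nsets E t. A \<subseteq> S}"
    proof
      fix R assume "R \<in> nsets (E - A) (t - card A)"
      then have "R \<subseteq> E - A" "finite R" "card R = t - card A" by (auto simp: nsets_def)
      moreover have "card (A \<union> R) = card A + card R"
        using calculation fA by (intro card_Un_disjoint) auto
      ultimately show "A \<union> R \<in> {S \<in> nsets E t. A \<subseteq> S}"
        using True assms fA by (auto simp: nsets_def)
    qed
  qed (auto simp: nsets_def card_Diff_subset fA)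
  then have "card {S \<in> nsets E t. A \<subseteq> S} = (card E - card A) choose (t - card A)"
    using assms fA by (simp add: bij_betw_same_card[symmetric] card_nsets card_Diff_subset)
  then show ?thesis
    using binomial_diff_mult_power_le[OF True assms(3)] assms
    by (simp add: power_divide field_simps)
next
  case False
  have empty: "{S \<in> nsets E t. A \<subseteq> S} = {}"
    using False by (auto simp: nsets_def dest: card_mono)
  show ?thesis unfolding empty by simp
qed

lemma sum_power_card_Pow:
  fixes q :: real
  assumes "finite D" shows "(\<Sum>A\<in>Pow D. q ^ card A) = (1 + q) ^ card D"
  using prod_add[OF assms, of "\<lambda>_. q" "\<lambda>_. 1"] by (simp add: add.commute)

text \<open>Markov's inequality for 2 to the power \<open>card (S \<inter> D)\<close>. This power
  counts the subsets of \<open>D\<close> contained in \<open>S\<close>, so its mean is a sum of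
  containment probabilities, at most \<open>(1 + t / card E) ^ card D\<close>.\<close>

lemma prob_nsets_inter_gt:
  assumes "finite E" "D \<subseteq> E" "0 < t" "t \<le> card E"
  shows "measure_pmf.prob (pmf_of_set (nsets E t)) {S. real (card (S \<inter> D)) > y}
    \<le> 2 powr (- y) * exp (real t * card D / card E)"
proof -
  let ?N = "nsets E t"
  have finD: "finite D" using assms finite_subset by blast
  have N: "?N \<noteq> {}" "finite ?N"
    using assms by (auto simp: nsets_ne finite_imp_finite_nsets)
  have "2 powr y * card {S \<in> ?N. real (card (S \<inter> D)) > y}
      = (\<Sum>S | S \<in> ?N \<and> real (card (S \<inter> D)) > y. 2 powr y)" by simp
  also have "\<dots> \<le> (\<Sum>S | S \<in> ?N \<and> real (card (S \<inter> D)) > y. 2 powr card (S \<inter> D))"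
    by (intro sum_mono) (auto simp: powr_mono)
  also have "\<dots> \<le> (\<Sum>S\<in>?N. 2 powr card (S \<inter> D))"
    using N by (intro sum_mono2) auto
  also have "\<dots> = (\<Sum>S\<in>?N. \<Sum>A\<in>Pow D. of_bool (A \<subseteq> S))"
  proof (rule sum.cong)
    fix S
    have "(\<Sum>A\<in>Pow D. of_bool (A \<subseteq> S)) = real (card {A \<in> Pow D. A \<subseteq> S})"
      using finD by (simp add: of_bool_def sum.If_cases Int_def)
    also have "{A \<in> Pow D. A \<subseteq> S} = Pow (S \<inter> D)" by auto
    also have "real (card (Pow (S \<inter> D))) = 2 powr card (S \<inter> D)"
      using finD by (subst card_Pow) (auto simp: powr_realpow)
    finally show "2 powr card (S \<inter> D) = (\<Sum>A\<in>Pow D. of_bool (A \<subseteq> S) :: real)" ..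
  qed simp
  also have "\<dots> = (\<Sum>A\<in>Pow D. \<Sum>S\<in>?N. of_bool (A \<subseteq> S))" by (rule sum.swap)
  also have "\<dots> = (\<Sum>A\<in>Pow D. real (card {S \<in> ?N. A \<subseteq> S}))"
    using N by (simp add: of_bool_def sum.If_cases Int_def)
  also have "\<dots> \<le> (\<Sum>A\<in>Pow D. real (card E choose t) * (real t / card E) ^ card A)"
    using assms by (intro sum_mono card_nsets_superset_le) auto
  also have "\<dots> = card ?N * (1 + real t / card E) ^ card D"
    using finD assms(1) by (simp add: sum_power_card_Pow card_nsets flip: sum_distrib_left)
  also have "\<dots> \<le> card ?N * exp (real t / card E) ^ card D"
    using exp_ge_add_one_self by (intro mult_left_mono power_mono) auto
  also have "exp (real t / card E) ^ card D = exp (real t * card D / card E)"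
    by (simp flip: exp_of_nat_mult)
  finally have "card {S \<in> ?N. real (card (S \<inter> D)) > y} / card ?N
      \<le> 2 powr (- y) * exp (real t * card D / card E)"
    using N assms(4) by (simp add: powr_minus field_simps)
  then show ?thesis using N by (simp add: measure_pmf_of_set Int_def)
qed


subsection \<open>Cliques inside blocks\<close>

text \<open>
  The blocks are the sets of vertices with a common value of \<open>v div N\<close>.
\<close>

definition local_sets :: "nat \<Rightarrow> nat set \<Rightarrow> nat \<Rightarrow> nat set set" where
  "local_sets N W k = {T \<in> nsets W k. \<exists>i. \<forall>v\<in>T. v div N = i}"

lemma nsets_Int: "nsets S k \<inter> nsets T k = nsets (S \<inter> T) k"
  by (auto simp: nsets_def)

lemma finite_local_sets: "finite W \<Longrightarrow> finite (local_sets N W k)"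
  by (simp add: local_sets_def finite_imp_finite_nsets)

lemma local_sets_mono: "W \<subseteq> V \<Longrightarrow> local_sets N W k \<subseteq> local_sets N V k"
  using nsets_mono[of W V k] by (auto simp: local_sets_def)

lemma nsets_subset_local_sets:
  assumes "T \<in> local_sets N W k" shows "nsets T 2 \<subseteq> local_sets N W 2"
proof
  fix e assume "e \<in> nsets T 2"
  then have "e \<subseteq> T" "finite e" "card e = 2" by (auto simp: nsets_def)
  moreover obtain i where "T \<subseteq> W" "\<forall>v\<in>T. v div N = i"
    using assms by (auto simp: local_sets_def nsets_def)
  ultimately show "e \<in> local_sets N W 2" unfolding local_sets_def nsets_def by blast
qed

lemma div_vimage_eq:
  assumes "0 < (N::nat)" shows "{v. v div N = i} = {i * N..<i * N + N}"
proof (intro equalityI subsetI)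
  fix v assume "v \<in> {v. v div N = i}"
  then show "v \<in> {i * N..<i * N + N}"
    using dividend_less_div_times[OF assms, of v] by (auto simp: add.commute)
next
  fix v assume "v \<in> {i * N..<i * N + N}"
  then show "v \<in> {v. v div N = i}"
    using div_nat_eqI[of N i v] by (simp add: algebra_simps)
qed

lemma card_block_le:
  assumes "0 < N" shows "card {v \<in> W. v div N = i} \<le> N"
proof -
  have "card {v \<in> W. v div N = i} \<le> card {v. v div N = i}"
    using div_vimage_eq[OF assms, of i] by (intro card_mono) auto
  then show ?thesis using assms by (simp add: div_vimage_eq)
qed

lemma card_local_sets_eq:
  assumes "0 < k" "W \<subseteq> {..n}"
  shows "card (local_sets N W k) = (\<Sum>i\<le>n div N. card {v \<in> W. v div N = i} choose k)"
proof -
  have finW: "finite W" using assms finite_subset by blast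
  have "local_sets N W k = (\<Union>i\<in>{..n div N}. nsets {v \<in> W. v div N = i} k)"
  proof (intro equalityI subsetI)
    fix T assume "T \<in> local_sets N W k"
    then obtain i where T: "T \<subseteq> W" "finite T" "card T = k" "\<forall>v\<in>T. v div N = i"
      by (auto simp: local_sets_def nsets_def)
    then obtain v where v: "v \<in> T" using assms by (metis card.empty ex_in_conv less_irrefl)
    then have "i \<le> n div N" using T assms by (metis atMost_iff div_le_mono subsetD)
    then show "T \<in> (\<Union>i\<in>{..n div N}. nsets {v \<in> W. v div N = i} k)"
      using T by (auto simp: nsets_def)
  qed (auto simp: local_sets_def nsets_def)
  moreover have "nsets {v \<in> W. v div N = i} k \<inter> nsets {v \<in> W. v div N = j} k = {}" if "i \<noteq> j" for i j
  proof -
    have "{v \<in> W. v div N = i} \<inter> {v \<in> W. v div N = j} = {}" using that by auto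
    then show ?thesis using assms(1) by (simp only: nsets_Int nsets_empty_iff) simp
  qed
  ultimately show ?thesis
    using finW by (simp add: card_UN_disjoint finite_imp_finite_nsets)
qed

lemma card_eq_sum_blocks:
  fixes n N :: nat
  assumes "W \<subseteq> {..n}" shows "card W = (\<Sum>i\<le>n div N. card {v \<in> W. v div N = i})"
proof -
  have finW: "finite W" using assms finite_subset by blast
  have "(\<lambda>v. v div N) ` W \<subseteq> {..n div N}"
    using assms by (auto intro!: div_le_mono)
  from sum.group[OF finW _ this, of "\<lambda>_. 1 :: nat"] show ?thesis by simp
qed

text \<open>A block with \<open>c\<close> vertices of \<open>W\<close> contributes at most
  \<open>c * N ^ (k - 1)\<close> sets because \<open>c \<le> N\<close>; the block sizes add up to
  \<open>card W\<close>.\<close>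

lemma card_local_sets_le:
  assumes "0 < N" "0 < k" "finite W"
  shows "card (local_sets N W k) \<le> card W * N ^ (k - 1)"
proof -
  obtain n where W: "W \<subseteq> {..n}" using assms(3) by (meson finite_nat_set_iff_bounded_le atMost_iff subsetI)
  have "c choose k \<le> c * N ^ (k - 1)" if "c \<le> N" for c
  proof (cases "k \<le> c")
    case True
    then have "c choose k \<le> c ^ k" by (rule binomial_le_pow)
    also have "\<dots> = c * c ^ (k - 1)" using assms(2) by (simp add: power_eq_if)
    also have "\<dots> \<le> c * N ^ (k - 1)" using that by (intro mult_left_mono power_mono) auto
    finally show ?thesis .
  qed (simp add: binomial_eq_0)
  then show ?thesis
    using card_block_le[OF assms(1), of W]
    by (simp add: card_local_sets_eq[OF assms(2) W] card_eq_sum_blocks[OF W, of N] sum_distrib_right sum_mono)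
qed

text \<open>
  The summand for a block with \<open>c\<close> vertices of \<open>W\<close> is bounded below by a function linear in \<open>c\<close> that
  vanishes at \<open>x\<close>; here \<open>2 * n / N\<close> bounds the number of blocks.
\<close>

lemma card_local_sets_ge:
  fixes x :: real
  assumes "0 < N" "N \<le> n" "0 < k" "k \<le> x" "W \<subseteq> {..n}"
  shows "(card W - 2 * real n / N * x) / k * (x / k) ^ (k - 1) \<le> card (local_sets N W k)"
proof -
  \<comment> \<open>For \<open>c \<ge> x\<close> compare with the bound \<open>(c / k) ^ k\<close>
    on the binomial coefficient; for smaller \<open>c\<close> the left-hand side is not
    positive.\<close>
  have b: "(real c - x) / k * (x / k) ^ (k - 1) \<le> real (c choose k)" for c
  proof (cases "x \<le> c")
    case True
    have "(real c - x) / k * (x / k) ^ (k - 1) \<le> (c / k) * (c / k) ^ (k - 1)"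
      using True assms by (intro mult_mono power_mono divide_right_mono) auto
    also have "\<dots> = (real c / k) ^ k" using assms(3) by (simp add: power_eq_if)
    also have "\<dots> \<le> real (c choose k)"
      using binomial_ge_n_over_k_pow_k[of k c, where 'a = real] True assms by simp
    finally show ?thesis .
  next
    case False
    then have "(real c - x) / k * (x / k) ^ (k - 1) \<le> 0"
      using assms by (intro mult_nonpos_nonneg divide_nonpos_nonneg zero_le_power) auto
    then show ?thesis by (smt (verit) of_nat_0_le_iff)
  qed
  have "real (n div N) + 1 \<le> 2 * real n / N"
  proof -
    have "real (n div N) \<le> n / N" by (rule of_nat_div_le_of_nat)
    moreover have "1 \<le> real n / N" using assms by simp
    ultimately show ?thesis by simp
  qed
  then have "(card W - 2 * real n / N * x) / k * (x / k) ^ (k - 1)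
      \<le> (card W - (real (n div N) + 1) * x) / k * (x / k) ^ (k - 1)"
    using assms by (intro mult_right_mono divide_right_mono diff_left_mono zero_le_power) auto
  also have "card W - (real (n div N) + 1) * x = (\<Sum>i\<le>n div N. real (card {v \<in> W. v div N = i}) - x)"
    by (simp add: sum_subtractf card_eq_sum_blocks[OF assms(5), of N] algebra_simps)
  also have "\<dots> / k * (x / k) ^ (k - 1)
      = (\<Sum>i\<le>n div N. (real (card {v \<in> W. v div N = i}) - x) / k * (x / k) ^ (k - 1))"
    by (simp add: sum_divide_distrib sum_distrib_right)
  also have "\<dots> \<le> (\<Sum>i\<le>n div N. real (card {v \<in> W. v div N = i} choose k))"
    by (intro sum_mono b)
  also have "\<dots> = card (local_sets N W k)"
    using assms by (simp add: card_local_sets_eq)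
  finally show ?thesis .
qed

section \<open>Pairs of block cliques that share an edge\<close>

lemma card_local_sets_inter_le:
  assumes "0 < N" "S \<in> local_sets N W r" "J \<noteq> {}"
  shows "card {T \<in> local_sets N W r. S \<inter> T = J} \<le> N ^ (r - card J)"
proof (cases "{T \<in> local_sets N W r. S \<inter> T = J} = {}")
  case False
  obtain i where i: "\<forall>v\<in>S. v div N = i" using assms(2) unfolding local_sets_def by blast
  let ?B = "{v. v div N = i}"
  have finB: "finite ?B" "card ?B = N" using assms(1) by (auto simp: div_vimage_eq)
  have *: "T \<subseteq> ?B" if T: "T \<in> local_sets N W r" "S \<inter> T = J" for T
  proof -
    obtain j where j: "\<forall>v\<in>T. v div N = j" using T(1) unfolding local_sets_def by blast
    obtain v where "v \<in> S \<inter> T" using T(2) assms(3) by blast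
    then have "v div N = i" "v div N = j" using i j by blast+
    then show ?thesis using j by blast
  qed
  \<comment> \<open>Meeting \<open>S\<close> confines \<open>T\<close> to the block of
    \<open>S\<close>, and with \<open>J\<close> fixed the remainder \<open>T - S\<close> determines
    \<open>T\<close>.\<close>
  have "card {T \<in> local_sets N W r. S \<inter> T = J} \<le> card (nsets ?B (r - card J))"
  proof (rule card_inj_on_le[where f = "\<lambda>T. T - S"])
    show "inj_on (\<lambda>T. T - S) {T \<in> local_sets N W r. S \<inter> T = J}"
    proof (rule inj_onI)
      fix T U assume "T \<in> {T \<in> local_sets N W r. S \<inter> T = J}"
        "U \<in> {T \<in> local_sets N W r. S \<inter> T = J}" "T - S = U - S"
      then have "S \<inter> T = S \<inter> U" "T - S = U - S" by auto
      then show "T = U" by blast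
    qed
    show "(\<lambda>T. T - S) ` {T \<in> local_sets N W r. S \<inter> T = J} \<subseteq> nsets ?B (r - card J)"
    proof
      fix R assume "R \<in> (\<lambda>T. T - S) ` {T \<in> local_sets N W r. S \<inter> T = J}"
      then obtain T where T: "R = T - S" "T \<in> local_sets N W r" "S \<inter> T = J" by blast
      have fT: "finite T" "card T = r" using T(2) by (auto simp: local_sets_def nsets_def)
      have RJ: "R = T - J" "J \<subseteq> T" using T(1) unfolding T(3)[symmetric] by blast+
      then have "finite J" using fT(1) finite_subset by blast
      then have "card R = r - card J" "finite R"
        using fT RJ by (simp_all add: card_Diff_subset)
      then show "R \<in> nsets ?B (r - card J)" using *[OF T(2,3)] T(1) unfolding nsets_def by blast
    qed
    show "finite (nsets ?B (r - card J))" by (rule finite_imp_finite_nsets[OF finB(1)])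
  qed
  also have "\<dots> \<le> N ^ (r - card J)"
    unfolding card_nsets finB
    by (cases "r - card J \<le> N") (auto simp: binomial_le_pow binomial_eq_0)
  finally show ?thesis .
next
  case True
  show ?thesis unfolding True by simp
qed

lemma two_mult_choose_two: "2 * (n choose 2) = n * (n - 1)"
  using binomial_absorption[of 1 n] by (simp add: numeral_2_eq_2)

lemma card_nsets_2_Un:
  assumes "finite S" "finite T" "card S = r" "card T = r"
  shows "card (nsets S 2 \<union> nsets T 2) = r * (r - 1) - (card (S \<inter> T) choose 2)"
proof -
  have "card (nsets S 2 \<union> nsets T 2) + card (nsets S 2 \<inter> nsets T 2) = card (nsets S 2) + card (nsets T 2)"
    using assms by (intro card_Un_Int[symmetric] finite_imp_finite_nsets)
  also have "\<dots> = 2 * (r choose 2)" using assms by simp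
  also have "\<dots> = r * (r - 1)" by (rule two_mult_choose_two)
  finally show ?thesis by (simp add: nsets_Int)
qed

text \<open>Bounds the expected contribution of the cliques meeting a given one in a fixed set of
  \<open>j\<close> vertices. After multiplication by \<open>N ^ (r - 1)\<close> the exponent of
  \<open>N\<close> is \<open>- (j - 1) * (r - j) / r\<close>, which is negative for
  \<open>2 \<le> j < r\<close>.\<close>

lemma clique_overlap_bound:
  fixes A :: real
  assumes "0 < N" "1 \<le> A" "2 \<le> j" "j < r"
  shows "real N ^ (r - j) * (A * N powr (- 2 / r)) ^ (r * (r - 1) - (j choose 2))
    \<le> A ^ (r * r) * N powr (- 1 / 3) / N ^ (r - 1)"
proof -
  define c where "c = r * (r - 1) - (j choose 2)"
  have "2 * (j choose 2) \<le> r * (r - 1)"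
    unfolding two_mult_choose_two using assms by (intro mult_le_mono) auto
  then have c1: "real c = real r * (real r - 1) - real (j choose 2)"
    using assms by (simp add: c_def of_nat_diff)
  have "real (2 * (j choose 2)) = real (j * (j - 1))" by (simp only: two_mult_choose_two)
  then have c2: "2 * real (j choose 2) = real j * (real j - 1)"
    using assms by (simp add: of_nat_diff)
  have cr: "c \<le> r * r" unfolding c_def
    by (rule order_trans[OF diff_le_self]) simp
  have prod: "real r / 3 \<le> (real j - 1) * (real r - real j)"
  proof -
    \<comment> \<open>The product \<open>(j - 1) * (r - j)\<close> exceeds this one by
      \<open>r - 2\<close>, and \<open>r - 2 \<ge> r / 3\<close> for \<open>r \<ge> 3\<close>. This
      is the origin of the exponent \<open>- 1 / 3\<close>.\<close>
    have "0 \<le> (real j - 2) * (real r - real j - 1)" using assms by (intro mult_nonneg_nonneg) auto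
    moreover have "real r \<ge> 3" using assms by simp
    ultimately show ?thesis by (simp add: algebra_simps)
  qed
  have expo: "real (r - 1) + real (r - j) + (- 2 / r) * c \<le> - 1 / 3"
  proof -
    have "real r * (real (r - 1) + real (r - j) + (- 2 / r) * c) = real r * (2 * real r - 1 - real j) - 2 * c"
      using assms by (simp add: field_simps of_nat_diff)
    also have "\<dots> = - ((real j - 1) * (real r - real j))"
      using c2 by (simp add: c1 algebra_simps)
    also have "\<dots> \<le> real r * (- 1 / 3)" using prod by simp
    finally show ?thesis using assms by (simp only: mult_le_cancel_left_pos of_nat_0_less_iff)
  qed
  have "real N ^ (r - 1) * (real N ^ (r - j) * (A * N powr (- 2 / r)) ^ c)
      = A ^ c * N powr (real (r - 1) + real (r - j) + (- 2 / r) * c)"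
    using assms by (simp add: power_mult_distrib powr_realpow[symmetric] powr_powr)
      (simp add: algebra_simps flip: powr_add)
  also have "\<dots> \<le> A ^ (r * r) * N powr (- 1 / 3)"
    using assms expo cr by (intro mult_mono power_increasing powr_mono) auto
  finally show ?thesis
    using assms by (simp add: field_simps c_def)
qed

text \<open>Group the partners \<open>T\<close> of \<open>S\<close> by
  \<open>J = S \<inter> T\<close>: a common edge forces \<open>card J \<ge> 2\<close>, and
  \<open>T \<noteq> S\<close> forces \<open>card J < r\<close>. At most \<open>2 ^ r\<close> sets
  \<open>J\<close> arise, and the number of choices of \<open>S\<close> cancels the denominator
  \<open>N ^ (r - 1)\<close>.\<close>

lemma clique_overlap_sum_le:
  fixes A p :: real
  assumes "0 < N" "1 \<le> A" "p = A * N powr (- 2 / r)" "finite W" "0 < r"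
  shows "(\<Sum>S\<in>local_sets N W r. \<Sum>T | T \<in> local_sets N W r \<and> T \<noteq> S \<and> nsets S 2 \<inter> nsets T 2 \<noteq> {}.
           p ^ card (nsets S 2 \<union> nsets T 2))
    \<le> card W * (2 ^ r * (A ^ (r * r) * N powr (- 1 / 3)))"
proof -
  let ?L = "local_sets N W r" and ?c = "A ^ (r * r) * N powr (- 1 / 3) / N ^ (r - 1)"
  have finL: "finite ?L" using assms by (simp add: finite_local_sets)
  have inner: "(\<Sum>T | T \<in> ?L \<and> T \<noteq> S \<and> nsets S 2 \<inter> nsets T 2 \<noteq> {}. p ^ card (nsets S 2 \<union> nsets T 2))
      \<le> 2 ^ r * ?c" if S: "S \<in> ?L" for S
  proof -
    let ?X = "{T \<in> ?L. T \<noteq> S \<and> nsets S 2 \<inter> nsets T 2 \<noteq> {}}"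
    let ?Y = "{J \<in> Pow S. 2 \<le> card J \<and> card J < r}"
    have fS: "finite S" "card S = r" using S by (auto simp: local_sets_def nsets_def)
    have T: "finite T" "card T = r" "S \<inter> T \<in> ?Y" if "T \<in> ?X" for T
    proof -
      show fT: "finite T" "card T = r" using that by (auto simp: local_sets_def nsets_def)
      have "\<not> card (S \<inter> T) < 2"
        using that fS by (auto simp: nsets_Int nsets_eq_empty_iff)
      moreover have "card (S \<inter> T) \<noteq> r"
      proof
        assume "card (S \<inter> T) = r"
        then have "S \<inter> T = S" "S \<inter> T = T"
          using fS fT by (intro card_subset_eq; simp)+
        then show False using that by simp
      qed
      moreover have "card (S \<inter> T) \<le> r" using fS by (metis card_mono inf_le1)
      ultimately show "S \<inter> T \<in> ?Y" by auto
    qed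
    have "(\<Sum>T\<in>?X. p ^ card (nsets S 2 \<union> nsets T 2))
        = (\<Sum>T\<in>?X. p ^ (r * (r - 1) - (card (S \<inter> T) choose 2)))"
      using T fS by (intro sum.cong refl) (simp add: card_nsets_2_Un)
    also have "\<dots> = (\<Sum>J\<in>?Y. \<Sum>T | T \<in> ?X \<and> S \<inter> T = J. p ^ (r * (r - 1) - (card (S \<inter> T) choose 2)))"
      using finL fS T by (intro sum.group[symmetric]) auto
    also have "\<dots> \<le> (\<Sum>J\<in>?Y. ?c)"
    proof (rule sum_mono)
      fix J assume J: "J \<in> ?Y"
      then have Jne: "J \<noteq> {}" by auto
      have "(\<Sum>T | T \<in> ?X \<and> S \<inter> T = J. p ^ (r * (r - 1) - (card (S \<inter> T) choose 2)))
          \<le> (\<Sum>T | T \<in> ?L \<and> S \<inter> T = J. p ^ (r * (r - 1) - (card J choose 2)))"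
      proof -
        have "(\<Sum>T | T \<in> ?X \<and> S \<inter> T = J. p ^ (r * (r - 1) - (card (S \<inter> T) choose 2)))
            = (\<Sum>T | T \<in> ?X \<and> S \<inter> T = J. p ^ (r * (r - 1) - (card J choose 2)))"
          by (intro sum.cong) auto
        also have "\<dots> \<le> (\<Sum>T | T \<in> ?L \<and> S \<inter> T = J. p ^ (r * (r - 1) - (card J choose 2)))"
          using finL assms(1-3) by (intro sum_mono2) auto
        finally show ?thesis .
      qed
      also have "\<dots> = card {T \<in> ?L. S \<inter> T = J} * p ^ (r * (r - 1) - (card J choose 2))" by simp
      also have "\<dots> \<le> real (N ^ (r - card J)) * p ^ (r * (r - 1) - (card J choose 2))"
        using assms(1-3) card_local_sets_inter_le[OF assms(1) S Jne]
        by (intro mult_right_mono of_nat_mono) auto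
      also have "\<dots> \<le> ?c"
        using clique_overlap_bound[OF assms(1,2), of "card J" r] J by (simp add: assms(3))
      finally show "(\<Sum>T | T \<in> ?X \<and> S \<inter> T = J. p ^ (r * (r - 1) - (card (S \<inter> T) choose 2))) \<le> ?c" .
    qed
    also have "\<dots> = card ?Y * ?c" by simp
    also have "\<dots> \<le> 2 ^ r * ?c"
    proof (rule mult_right_mono)
      have "card ?Y \<le> card (Pow S)" using fS by (intro card_mono) auto
      then show "real (card ?Y) \<le> 2 ^ r" using fS by (simp add: card_Pow)
    qed (use assms in auto)
    finally show ?thesis .
  qed
  have "(\<Sum>S\<in>?L. \<Sum>T | T \<in> ?L \<and> T \<noteq> S \<and> nsets S 2 \<inter> nsets T 2 \<noteq> {}. p ^ card (nsets S 2 \<union> nsets T 2))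
      \<le> card ?L * (2 ^ r * ?c)"
    using sum_bounded_above[of ?L _ "2 ^ r * ?c"] inner by simp
  also have "\<dots> \<le> real (card W * N ^ (r - 1)) * (2 ^ r * ?c)"
    using assms card_local_sets_le[OF assms(1,5,4)] by (intro mult_right_mono of_nat_mono) auto
  also have "\<dots> = card W * (2 ^ r * (A ^ (r * r) * N powr (- 1 / 3)))"
    using assms by simp
  finally show ?thesis .
qed


subsection \<open>Dense block cliques and the greedy strategy\<close>

text \<open>An increasing property of the presented edges. Only cliques inside blocks count, because
  Builder keeps no other edges.\<close>

definition clique_dense :: "nat \<Rightarrow> nat \<Rightarrow> nat \<Rightarrow> real \<Rightarrow> nat set set \<Rightarrow> bool" where
  "clique_dense N n r \<epsilon> F \<longleftrightarrow>
     (\<forall>W\<subseteq>{1..n}. \<epsilon> * n \<le> card W \<longrightarrow> (\<exists>T\<in>local_sets N W r. nsets T 2 \<subseteq> F))"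

lemma clique_dense_mono: "clique_dense N n r \<epsilon> F \<Longrightarrow> F \<subseteq> G \<Longrightarrow> clique_dense N n r \<epsilon> G"
  unfolding clique_dense_def by (meson subset_trans)

lemma isomorphic_complete_ugraph:
  assumes "finite T" "card T = r"
  shows "isomorphic (complete_ugraph r) (T, nsets T 2)"
proof -
  obtain f where f: "bij_betw f {1..r} T"
    using assms by (metis card_atLeastAtMost diff_Suc_1 finite_atLeastAtMost finite_same_card_bij)
  then have "(\<lambda>e. f ` e) ` nsets {1..r} 2 = nsets T 2"
    using bij_betw_nsets[OF f, of 2] by (simp add: bij_betw_def)
  then show ?thesis using f by (auto simp: isomorphic_def complete_ugraph_def)
qed

lemma has_factor_of_clique_dense:
  assumes "0 < r" "clique_dense N n r (1 - \<alpha>) F"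
  shows "has_factor \<alpha> (complete_ugraph r) ({1..n}, F \<inter> local_sets N {1..n} 2)"
proof -
  define L where "L = {T \<in> local_sets N {1..n} r. nsets T 2 \<subseteq> F}"
  have L: "T \<subseteq> {1..n}" "finite T" "card T = r" "nsets T 2 \<subseteq> F \<inter> local_sets N {1..n} 2" if "T \<in> L" for T
  proof -
    have T: "T \<in> local_sets N {1..n} r" "nsets T 2 \<subseteq> F" using that by (auto simp: L_def)
    then show "T \<subseteq> {1..n}" "finite T" "card T = r"
      unfolding local_sets_def nsets_def by blast+
    show "nsets T 2 \<subseteq> F \<inter> local_sets N {1..n} 2"
      using nsets_subset_local_sets[OF T(1)] T(2) by blast
  qed
  have finL: "finite L" by (simp add: L_def finite_local_sets)
  have "finite {C. C \<subseteq> L \<and> pairwise disjnt C}" "{} \<in> {C. C \<subseteq> L \<and> pairwise disjnt C}"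
    using finL by (auto intro: finite_subset[of _ "Pow L"])
  from finite_has_maximal2[OF this] obtain C where C: "C \<subseteq> L" "pairwise disjnt C"
    and "\<forall>C'\<in>{C. C \<subseteq> L \<and> pairwise disjnt C}. C \<subseteq> C' \<longrightarrow> C = C'"
    by auto
  then have maximal: "C = C'" if "C' \<subseteq> L" "pairwise disjnt C'" "C \<subseteq> C'" for C'
    using that by simp
  have finC: "finite C" using C finL finite_subset by blast
  define W where "W = {1..n} - \<Union>C"
  \<comment> \<open>Otherwise the uncovered set would contain a clique, and adding it would
    contradict maximality.\<close>
  have "\<not> (1 - \<alpha>) * n \<le> card W"
  proof
    assume "(1 - \<alpha>) * n \<le> card W"
    moreover have "W \<subseteq> {1..n}" by (auto simp: W_def)
    ultimately obtain T where T: "T \<in> local_sets N W r" "nsets T 2 \<subseteq> F"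
      using assms(2) unfolding clique_dense_def by blast
    then have TL: "T \<in> L" using local_sets_mono[OF \<open>W \<subseteq> {1..n}\<close>] by (auto simp: L_def)
    have "T \<subseteq> W" using T(1) by (auto simp: local_sets_def nsets_def)
    then have "T \<inter> \<Union>C = {}" by (auto simp: W_def)
    then have "pairwise disjnt (insert T C)"
      using C(2) by (auto simp: pairwise_insert disjnt_def)
    then have "C = insert T C" using C(1) TL by (intro maximal) auto
    then have "T \<in> C" by blast
    then have "T = {}" using \<open>T \<inter> \<Union>C = {}\<close> by blast
    then show False using L(3)[OF TL] assms(1) by simp
  qed
  moreover have "card (\<Union>C) = r * card C"
  proof -
    have "card (\<Union>C) = (\<Sum>T\<in>C. card T)"
      using C L(2) by (intro card_Union_disjoint) blast+
    also have "\<dots> = (\<Sum>T\<in>C. r)" using C(1) L(3) by (intro sum.cong) blast+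
    finally show ?thesis by simp
  qed
  moreover have "card W + card (\<Union>C) = n"
  proof -
    have sub: "\<Union>C \<subseteq> {1..n}" using C(1) L(1) by blast
    then have "finite (\<Union>C)" by (rule finite_subset) simp
    then show ?thesis using sub card_mono[OF _ sub] by (simp add: W_def card_Diff_subset)
  qed
  then have "real (card W) + real (card (\<Union>C)) = real n" by (simp flip: of_nat_add)
  ultimately have cardC: "\<alpha> * n \<le> r * real (card C)"
    by (simp add: algebra_simps)
  let ?C = "(\<lambda>T. (T, nsets T 2)) ` C"
  have "subgraph H ({1..n}, F \<inter> local_sets N {1..n} 2) \<and> isomorphic (complete_ugraph r) H"
    if "H \<in> ?C" for H
  proof -
    obtain T where T: "T \<in> L" "H = (T, nsets T 2)" using \<open>H \<in> ?C\<close> C(1) by blast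
    then show ?thesis
      using L[OF T(1)] isomorphic_complete_ugraph[of T r] by (simp add: subgraph_def)
  qed
  moreover have "pairwise (\<lambda>H H'. verts H \<inter> verts H' = {}) ?C"
    using C(2) by (auto simp: pairwise_def disjnt_def)
  moreover have "card ?C = card C" by (intro card_image) (auto simp: inj_on_def)
  moreover have "\<alpha> * n / r \<le> card C"
    using cardC assms(1) by (simp add: field_simps)
  ultimately show ?thesis
    unfolding has_factor_def using finC
    by (intro exI[of _ ?C] conjI ballI) (simp_all add: complete_ugraph_def)
qed

section \<open>Block cliques in the binomial random graph\<close>

lemma bexp_no_local_clique_le:
  fixes A \<epsilon> p :: real
  assumes "0 < N" "N \<le> n" "0 < r" "0 < \<epsilon>" "real r \<le> \<epsilon> * N / 4" "1 \<le> A"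
    and A: "3 \<le> A ^ (r choose 2) * (\<epsilon> / (2 * r) * (\<epsilon> / (4 * r)) ^ (r - 1))"
    and p: "p = A * N powr (- 2 / r)" "p \<le> 1"
    and N: "2 ^ r * (A ^ (r * r) * N powr (- 1 / 3)) \<le> 1"
    and W: "W \<subseteq> {1..n}" "\<epsilon> * n \<le> card W"
  shows "bexp p (nsets {1..n} 2) (\<lambda>F. of_bool (\<forall>T\<in>local_sets N W r. \<not> nsets T 2 \<subseteq> F)) \<le> exp (- 2 * n)"
proof -
  let ?L = "local_sets N W r"
  \<comment> \<open>With this \<open>x\<close> the loss \<open>2 * n / N * x\<close> in the lower
    count is \<open>\<epsilon> * n / 2\<close>, half of the guaranteed size of
    \<open>W\<close>.\<close>
  let ?x = "\<epsilon> * N / 4"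
  have finW: "finite W" using W(1) finite_subset by blast
  have cardT: "card T = r" "finite T" "T \<subseteq> W" if "T \<in> ?L" for T
    using that by (auto simp: local_sets_def nsets_def)
  have p0: "0 \<le> p" using assms(6) by (simp add: p)
  have cW: "card W \<le> n" using card_mono[OF _ W(1)] by simp
  have "bexp p (nsets {1..n} 2) (\<lambda>F. of_bool (\<forall>T\<in>?L. \<not> nsets T 2 \<subseteq> F))
      \<le> exp (- (\<Sum>T\<in>?L. p ^ card (nsets T 2)) + (\<Sum>S\<in>?L. \<Sum>T | T \<in> ?L \<and> T \<noteq> S \<and> nsets S 2 \<inter> nsets T 2 \<noteq> {}.
           p ^ card (nsets S 2 \<union> nsets T 2)))"
  proof (rule Janson_inequality)
    show "nsets T 2 \<subseteq> nsets {1..n} 2" if "T \<in> ?L" for T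
      using cardT(3)[OF that] W(1) by (intro nsets_mono) blast
  qed (use p p0 finW in \<open>auto simp: finite_local_sets finite_imp_finite_nsets\<close>)
  \<comment> \<open>The mean is at least \<open>3 * n\<close> by the choice of \<open>A\<close>, and
    the correlation sum at most \<open>n\<close> since \<open>N\<close> is large.\<close>
  also have "\<dots> \<le> exp (- (3 * real n) + real n)"
  proof (subst exp_le_cancel_iff, intro add_mono le_imp_neg_le)
    have "(\<Sum>T\<in>?L. p ^ card (nsets T 2)) = card ?L * p ^ (r choose 2)"
      using cardT by simp
    \<comment> \<open>Since \<open>2 / r\<close> times \<open>r choose 2\<close> is
      \<open>r - 1\<close>, the clique probability cancels the factor \<open>N ^ (r - 1)\<close> in
      the clique count, which makes the mean linear in \<open>n\<close>.\<close>
    also have pr: "p ^ (r choose 2) = A ^ (r choose 2) / N ^ (r - 1)"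
    proof -
      have "real (2 * (r choose 2)) = real r * real (r - 1)"
        by (simp only: two_mult_choose_two of_nat_mult)
      then have "- 2 / real r * real (r choose 2) = - real (r - 1)"
        using assms(3) by (simp add: field_simps)
      then have "(N powr (- 2 / r)) ^ (r choose 2) = N powr (- real (r - 1))"
        using assms(1) by (simp only: powr_powr powr_realpow[symmetric] powr_gt_zero of_nat_0_less_iff)
      then show ?thesis
        using assms(1) by (simp add: p(1) power_mult_distrib powr_minus powr_realpow divide_inverse)
    qed
    finally have mu: "(\<Sum>T\<in>?L. p ^ card (nsets T 2)) = card ?L * (A ^ (r choose 2) / N ^ (r - 1))" .
    have "\<epsilon> * n / 2 = \<epsilon> * n - 2 * real n / N * ?x" using assms(1) by simp
    also have "\<dots> \<le> card W - 2 * real n / N * ?x" using W(2) by simp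
    finally have "\<epsilon> * n / 2 / r * (?x / r) ^ (r - 1) \<le> (card W - 2 * real n / N * ?x) / r * (?x / r) ^ (r - 1)"
      using assms by (intro mult_right_mono divide_right_mono zero_le_power) auto
    also have "\<dots> \<le> card ?L"
      using assms W(1) by (intro card_local_sets_ge) auto
    finally have cL: "\<epsilon> * n / 2 / r * (?x / r) ^ (r - 1) \<le> card ?L" .
    have "3 * real n \<le> n * (A ^ (r choose 2) * (\<epsilon> / (2 * r) * (\<epsilon> / (4 * r)) ^ (r - 1)))"
      using mult_left_mono[OF A, of n] by simp
    also have "\<dots> = (\<epsilon> * n / 2 / r * (?x / r) ^ (r - 1)) * (A ^ (r choose 2) / N ^ (r - 1))"
    proof -
      have "(?x / r) ^ (r - 1) = (\<epsilon> / (4 * r)) ^ (r - 1) * N ^ (r - 1)"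
        by (simp flip: power_mult_distrib)
      then show ?thesis using assms(1) by simp
    qed
    also have "\<dots> \<le> card ?L * (A ^ (r choose 2) / N ^ (r - 1))"
      using cL assms(6) by (intro mult_right_mono) auto
    finally show "3 * real n \<le> (\<Sum>T\<in>?L. p ^ card (nsets T 2))" unfolding mu .
    have "(\<Sum>S\<in>?L. \<Sum>T | T \<in> ?L \<and> T \<noteq> S \<and> nsets S 2 \<inter> nsets T 2 \<noteq> {}. p ^ card (nsets S 2 \<union> nsets T 2))
        \<le> card W * (2 ^ r * (A ^ (r * r) * N powr (- 1 / 3)))"
      by (rule clique_overlap_sum_le[OF assms(1,6) p(1) finW assms(3)])
    also have "\<dots> \<le> real n * 1"
      using N cW assms(6) by (intro mult_mono) auto
    finally show "(\<Sum>S\<in>?L. \<Sum>T | T \<in> ?L \<and> T \<noteq> S \<and> nsets S 2 \<inter> nsets T 2 \<noteq> {}. p ^ card (nsets S 2 \<union> nsets T 2)) \<le> n"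
      by simp
  qed
  finally show ?thesis by simp
qed

lemma bexp_not_clique_dense_le:
  fixes p \<epsilon> :: real
  assumes "0 \<le> p" "p \<le> 1"
    and "\<And>W. W \<subseteq> {1..n} \<Longrightarrow> \<epsilon> * n \<le> card W \<Longrightarrow>
      bexp p (nsets {1..n} 2) (\<lambda>F. of_bool (\<forall>T\<in>local_sets N W r. \<not> nsets T 2 \<subseteq> F)) \<le> exp (- 2 * real n)"
  shows "bexp p (nsets {1..n} 2) (\<lambda>F. of_bool (\<not> clique_dense N n r \<epsilon> F)) \<le> exp (- real n)"
proof -
  let ?Ws = "{W \<in> Pow {1..n}. \<epsilon> * n \<le> card W}"
  let ?f = "\<lambda>W F. of_bool (\<forall>T\<in>local_sets N W r. \<not> nsets T 2 \<subseteq> F) :: real"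
  have "bexp p (nsets {1..n} 2) (\<lambda>F. of_bool (\<not> clique_dense N n r \<epsilon> F))
      \<le> bexp p (nsets {1..n} 2) (\<lambda>F. \<Sum>W\<in>?Ws. ?f W F)"
  proof (rule bexp_mono)
    fix F
    show "of_bool (\<not> clique_dense N n r \<epsilon> F) \<le> (\<Sum>W\<in>?Ws. ?f W F)"
    proof (cases "clique_dense N n r \<epsilon> F")
      case False
      then obtain W where W: "W \<in> ?Ws" "?f W F = 1"
        unfolding clique_dense_def by auto
      then have "1 \<le> (\<Sum>W\<in>?Ws. ?f W F)"
        using member_le_sum[of W ?Ws "\<lambda>W. ?f W F"] by simp
      then show ?thesis using False by simp
    qed (simp add: sum_nonneg)
  qed (use assms in auto)
  also have "\<dots> \<le> (\<Sum>W\<in>?Ws. exp (- 2 * real n))"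
    unfolding bexp_sum using assms(3) by (intro sum_mono) auto
  also have "\<dots> = card ?Ws * exp (- 2 * real n)" by simp
  \<comment> \<open>There are at most \<open>2 ^ n \<le> exp n\<close> sets \<open>W\<close>, which
    uses up half of the exponent \<open>- 2 * n\<close>.\<close>
  also have "\<dots> \<le> exp (real n) * exp (- 2 * real n)"
  proof (rule mult_right_mono)
    have "card ?Ws \<le> card (Pow {1..n})" by (intro card_mono) auto
    then have "real (card ?Ws) \<le> 2 ^ n" by (simp add: card_Pow)
    also have "\<dots> \<le> exp 1 ^ n"
      using exp_ge_add_one_self[of "1 :: real"] by (intro power_mono) auto
    finally show "real (card ?Ws) \<le> exp (real n)" by (simp flip: exp_of_nat_mult)
  qed simp
  finally show ?thesis by (simp flip: exp_add)
qed

lemma exists_clique_dense_constants: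
  fixes \<epsilon> :: real
  assumes "2 \<le> r" "0 < \<epsilon>"
  shows "\<exists>A\<ge>1. \<forall>\<^sub>F N in sequentially. A * N powr (- 2 / r) \<le> 1 \<and>
    (\<forall>n\<ge>N. bexp (A * N powr (- 2 / r)) (nsets {1..n} 2)
       (\<lambda>F. of_bool (\<not> clique_dense N n r \<epsilon> F)) \<le> exp (- real n))"
proof -
  \<comment> \<open>\<open>\<kappa>\<close> collects the constants of the lower bound on the mean.
    \<open>A\<close> depends on \<open>r\<close> and \<open>\<epsilon>\<close> only and is fixed
    before \<open>N\<close> is taken large.\<close>
  define \<kappa> where "\<kappa> = \<epsilon> / (2 * r) * (\<epsilon> / (4 * r)) ^ (r - 1)"
  define A where "A = max 1 (3 / \<kappa>)"
  have \<kappa>: "0 < \<kappa>" using assms by (simp add: \<kappa>_def)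
  have A1: "1 \<le> A" by (simp add: A_def)
  have r2: "1 \<le> r choose 2" using assms(1) by (simp add: Suc_le_eq zero_less_binomial)
  have "3 \<le> A * \<kappa>" using \<kappa> by (simp add: A_def max_def field_simps)
  also have "\<dots> \<le> A ^ (r choose 2) * \<kappa>"
    using \<kappa> power_increasing[OF r2 A1] by (intro mult_right_mono) auto
  finally have A: "3 \<le> A ^ (r choose 2) * \<kappa>" .
  have lim: "((\<lambda>N. c * real N powr (- s)) \<longlongrightarrow> 0) sequentially" if "0 < s" for c s :: real
    using tendsto_mult_right_zero[OF tendsto_neg_powr[OF _ filterlim_real_sequentially, of "- s"]] that by simp
  have "\<forall>\<^sub>F N in sequentially. A * real N powr (- (2 / r)) < 1"
    using order_tendstoD(2)[OF lim[of "2 / r" A]] assms by simp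
  moreover have "\<forall>\<^sub>F N in sequentially. 2 ^ r * A ^ (r * r) * real N powr (- (1 / 3)) < 1"
    using order_tendstoD(2)[OF lim[of "1 / 3" "2 ^ r * A ^ (r * r)"]] by simp
  moreover have "\<forall>\<^sub>F N in sequentially. real r * 4 / \<epsilon> \<le> real N"
    using filterlim_real_sequentially unfolding filterlim_at_top by blast
  moreover have "\<forall>\<^sub>F N in sequentially. 0 < (N :: nat)" by (rule eventually_gt_at_top)
  ultimately have "\<forall>\<^sub>F N in sequentially. A * N powr (- 2 / r) \<le> 1 \<and>
    (\<forall>n\<ge>N. bexp (A * N powr (- 2 / r)) (nsets {1..n} 2)
       (\<lambda>F. of_bool (\<not> clique_dense N n r \<epsilon> F)) \<le> exp (- real n))"
  proof eventually_elim
    case (elim N)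
    have p1: "A * N powr (- 2 / r) \<le> 1" using elim(1) by simp
    have "bexp (A * N powr (- 2 / r)) (nsets {1..n} 2)
       (\<lambda>F. of_bool (\<not> clique_dense N n r \<epsilon> F)) \<le> exp (- real n)" if "N \<le> n" for n
    proof (rule bexp_not_clique_dense_le)
      fix W assume W: "W \<subseteq> {1..n}" "\<epsilon> * n \<le> card W"
      show "bexp (A * N powr (- 2 / r)) (nsets {1..n} 2)
        (\<lambda>F. of_bool (\<forall>T\<in>local_sets N W r. \<not> nsets T 2 \<subseteq> F)) \<le> exp (- 2 * real n)"
      proof (rule bexp_no_local_clique_le[OF elim(4) that _ assms(2) _ A1 _ refl p1 _ W])
        show "real r \<le> \<epsilon> * N / 4" using elim(3) assms(2) by (simp add: field_simps)
        show "2 ^ r * (A ^ (r * r) * N powr (- 1 / 3)) \<le> 1" using elim(2) by (simp add: mult.assoc)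
      qed (use assms A \<kappa>_def in auto)
    qed (use p1 A1 in auto)
    with p1 show ?case by blast
  qed
  with A1 show ?thesis by blast
qed

section \<open>The capped greedy strategy and its success probability\<close>

definition greedy_strategy :: "nat \<Rightarrow> edge set \<Rightarrow> strategy" where
  "greedy_strategy b D h e = return_pmf (e \<in> D \<and> card (purchased h) < b)"

lemma purchased_append: "purchased (h @ [(e, x)]) = (if x then insert e (purchased h) else purchased h)"
  by (auto simp: purchased_def)

lemma finite_purchased: "finite (purchased h)"
proof (rule finite_subset)
  show "purchased h \<subseteq> fst ` set h" by (force simp: purchased_def)
qed simp

text \<open>The rule is deterministic, so play ends in a single history. The cap enforces the budget
  on every input, and it costs nothing when all wanted edges fit.\<close>

lemma play_greedy_strategy:
  assumes "card (purchased h) \<le> b"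
  shows "\<exists>h'. play (greedy_strategy b D) h es = return_pmf h' \<and> card (purchased h') \<le> b \<and>
    (card (purchased h \<union> (set es \<inter> D)) \<le> b \<longrightarrow> purchased h' = purchased h \<union> (set es \<inter> D))"
  using assms
proof (induction es arbitrary: h)
  case (Cons e es)
  let ?x = "e \<in> D \<and> card (purchased h) < b"
  let ?h = "h @ [(e, ?x)]"
  have step: "play (greedy_strategy b D) h (e # es) = play (greedy_strategy b D) ?h es"
    by (simp add: greedy_strategy_def bind_return_pmf)
  have "card (purchased ?h) \<le> b"
    using Cons.prems finite_purchased[of h] by (auto simp: purchased_append card_insert_if)
  from Cons.IH[OF this] obtain h' where h': "play (greedy_strategy b D) ?h es = return_pmf h'"
    "card (purchased h') \<le> b"
    "card (purchased ?h \<union> (set es \<inter> D)) \<le> b \<Longrightarrow> purchased h' = purchased ?h \<union> (set es \<inter> D)"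
    by blast
  have "purchased h' = purchased h \<union> (set (e # es) \<inter> D)"
    if le: "card (purchased h \<union> (set (e # es) \<inter> D)) \<le> b"
  proof -
    have "purchased ?h \<union> (set es \<inter> D) = purchased h \<union> (set (e # es) \<inter> D)"
    proof (cases "e \<in> D \<and> \<not> ?x")
      \<comment> \<open>The budget is spent although \<open>e\<close> is wanted. As everything
        wanted fits into \<open>b\<close>, the purchases already comprise all of it, including
        \<open>e\<close>.\<close>
      case True
      then have "purchased h \<union> (set (e # es) \<inter> D) = purchased h"
        using le Cons.prems finite_purchased[of h]
        by (intro card_seteq[symmetric]) auto
      then have "e \<in> purchased h" using True by auto
      then show ?thesis using True by (auto simp: purchased_append)
    next
      case False
      then show ?thesis by (auto simp: purchased_append)
    qed
    then show ?thesis using h'(3) le by simp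
  qed
  then show ?case unfolding step using h'(1,2) by blast
qed simp

lemma is_strategy_greedy_strategy: "is_strategy n t b (greedy_strategy b D)"
proof -
  have "card (purchased h) \<le> b" if "h \<in> set_pmf (play (greedy_strategy b D) [] es)" for h es
    using play_greedy_strategy[of "[]" b D es] that by (auto simp: purchased_def)
  then show ?thesis by (auto simp: is_strategy_def history_pmf_def)
qed

lemma prob_greedy_strategy_ge:
  fixes p y :: real
  defines "E n \<equiv> nsets {1..n} 2"
  assumes "0 < r" "0 < t" "t \<le> card (E n)" "0 \<le> p" "p \<le> 1" "p * card (E n) \<le> t / 2" "y < real b + 1"
  shows "measure_pmf.prob (builder_graph n t (greedy_strategy b (local_sets N {1..n} 2)))
        {G. has_factor \<alpha> (complete_ugraph r) G}
    \<ge> 1 - (2 * bexp p (E n) (\<lambda>F. of_bool (\<not> clique_dense N n r (1 - \<alpha>) F))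
        + 2 powr (- y) * exp (real t * card (local_sets N {1..n} 2) / card (E n)))"
proof -
  let ?D = "local_sets N {1..n} 2"
  let ?G = "builder_graph n t (greedy_strategy b ?D)"
  let ?U = "pmf_of_set (nsets (E n) t)"
  have finE: "finite (E n)" by (simp add: E_def finite_imp_finite_nsets)
  have DE: "?D \<subseteq> E n" by (auto simp: local_sets_def E_def)
  \<comment> \<open>\<open>H\<close> names the single history in which play on \<open>es\<close>
    ends.\<close>
  define H where "H es = (SOME h'. play (greedy_strategy b ?D) [] es = return_pmf h' \<and> card (purchased h') \<le> b \<and>
    (card (set es \<inter> ?D) \<le> b \<longrightarrow> purchased h' = set es \<inter> ?D))" for es
  have H: "play (greedy_strategy b ?D) [] es = return_pmf (H es)"
    "card (set es \<inter> ?D) \<le> b \<Longrightarrow> purchased (H es) = set es \<inter> ?D" for es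
    using someI_ex[OF play_greedy_strategy[of "[]" b ?D es]]
    by (simp_all add: purchased_def H_def)
  have G: "?G = map_pmf (\<lambda>es. ({1..n}, purchased (H (take t es)))) (pmf_of_set (permutations_of_set (E n)))"
    by (simp add: builder_graph_def history_pmf_def edge_order_def complete_ugraph_def H E_def
        bind_assoc_pmf bind_return_pmf map_pmf_def del: One_nat_def)
  let ?bad1 = "{F. \<not> clique_dense N n r (1 - \<alpha>) F}" and ?bad2 = "{F. real (card (F \<inter> ?D)) > y}"
  have good: "has_factor \<alpha> (complete_ugraph r) ({1..n}, purchased (H es))"
    if "set es \<notin> ?bad1 \<union> ?bad2" for es
  proof -
    \<comment> \<open>An integer that is at most \<open>y < b + 1\<close> is at most
      \<open>b\<close>.\<close>
    have "card (set es \<inter> ?D) \<le> b" using that assms(8) by simp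
    then show ?thesis
      using H(2)[of es] has_factor_of_clique_dense[OF assms(2), of N n \<alpha> "set es"] that by simp
  qed
  have "1 - measure_pmf.prob ?G {G. has_factor \<alpha> (complete_ugraph r) G}
      = measure_pmf.prob ?G {G. \<not> has_factor \<alpha> (complete_ugraph r) G}"
    by (simp add: measure_pmf.prob_compl[symmetric] Compl_eq_Diff_UNIV[symmetric] Collect_neg_eq)
  also have "\<dots> \<le> measure_pmf.prob (map_pmf (\<lambda>es. set (take t es)) (pmf_of_set (permutations_of_set (E n)))) (?bad1 \<union> ?bad2)"
    unfolding G measure_map_pmf using good
    by (intro measure_pmf.finite_measure_mono) auto
  also have "\<dots> = measure_pmf.prob ?U (?bad1 \<union> ?bad2)"
    using finE assms(4) by (simp add: map_pmf_take_permutation)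
  also have "\<dots> \<le> measure_pmf.prob ?U ?bad1 + measure_pmf.prob ?U ?bad2"
    by (intro measure_Un_le) auto
  also have "\<dots> \<le> 2 * bexp p (E n) (\<lambda>F. of_bool (\<not> clique_dense N n r (1 - \<alpha>) F))
        + 2 powr (- y) * exp (real t * card ?D / card (E n))"
    using assms finE DE clique_dense_mono
    by (intro add_mono prob_nsets_le_bexp prob_nsets_inter_gt) blast+
  finally show ?thesis by linarith
qed


subsection \<open>The block length\<close>

text \<open>For positive \<open>n\<close> and \<open>t\<close>, the least \<open>N\<close> with
  \<open>A * N powr (- 2 / r) \<le> t / n ^ 2\<close>, so that a binomial graph of this density has
  at most \<open>t / 2\<close> edges in expectation.\<close>

definition block_length :: "real \<Rightarrow> nat \<Rightarrow> nat \<Rightarrow> nat \<Rightarrow> nat" where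
  "block_length A r n t = nat \<lceil>(A * real n ^ 2 / real t) powr (real r / 2)\<rceil>"

text \<open>Here \<open>x\<close> is the order of the budget. The lower bound on \<open>t\<close>
  keeps blocks no longer than \<open>n\<close>, the bound \<open>n ^ 2 / t \<le> N\<close> makes
  them long, and \<open>n \<le> x\<close> turns a tail exponential in \<open>x\<close> into one
  exponential in \<open>n\<close>.\<close>

lemma block_length_bounds:
  fixes A :: real and r n t :: nat
  defines "N \<equiv> block_length A r n t"
    and "x \<equiv> real n ^ (r - 1) / real t powr (real r / 2 - 1)"
  assumes r: "2 \<le> r" and A: "1 \<le> A" and n: "2 \<le> n"
    and t: "2 * A * real n powr (2 - 2 / real r) \<le> real t" "4 * real t \<le> real n ^ 2"
  shows "0 < t" "real n ^ 2 / real t \<le> real N" "0 < N" "N \<le> n"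
    "A * real N powr (- 2 / r) * card (nsets {1..n} 2) \<le> t / 2"
    "t \<le> card (nsets {1..n} 2)"
    "real t * card (local_sets N {1..n} 2) / card (nsets {1..n} 2) \<le> 8 * A powr (real r / 2) * x"
    "real n \<le> x"
proof -
  define z where "z = A * real n ^ 2 / real t"
  define E where "E = real (card (nsets {1..n} 2))"
  have "0 < 2 * A * real n powr (2 - 2 / real r)" using A n by simp
  with t(1) show t0: "0 < t" by (metis of_nat_0_less_iff order_less_le_trans)
  have E: "E = real n * (real n - 1) / 2"
  proof -
    have "2 * E = real (2 * (n choose 2))" by (simp add: E_def)
    also have "\<dots> = real n * (real n - 1)"
      unfolding two_mult_choose_two using n by (simp add: of_nat_diff)
    finally show ?thesis by simp
  qed
  have E1: "E \<le> real n ^ 2 / 2" by (simp add: E power2_eq_square algebra_simps)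
  have "real n * 2 \<le> real n * real n" using n by (intro mult_left_mono) auto
  then have E2: "real n ^ 2 / 4 \<le> E" by (simp add: E power2_eq_square field_simps)
  have tn: "real t \<le> real n ^ 2" using t(2) by linarith
  then have q1: "1 \<le> real n ^ 2 / real t" using t0 by (simp only: pos_le_divide_eq of_nat_0_less_iff mult_1)
  have zq: "z = A * (real n ^ 2 / real t)" by (simp add: z_def)
  have qz: "real n ^ 2 / real t \<le> z"
    unfolding zq using mult_right_mono[OF A, of "real n ^ 2 / real t"] q1 by simp
  have z1: "1 \<le> z" using q1 qz by linarith
  have zr: "z \<le> z powr (real r / 2)"
    using powr_mono[of 1 "real r / 2" z] z1 r by simp
  have N: "N = nat \<lceil>z powr (real r / 2)\<rceil>" by (simp add: N_def block_length_def z_def)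
  have Nz: "z powr (real r / 2) \<le> N" unfolding N by (rule of_nat_ceiling)
  then show qN: "real n ^ 2 / real t \<le> real N" using qz zr by linarith
  then show N0: "0 < N" using q1 by linarith
  have "real N < z powr (real r / 2) + 1" unfolding N
    using ceiling_correct[of "z powr (real r / 2)"] z1 zr by (simp add: of_nat_nat)
  \<comment> \<open>Rounding up costs at most a factor 2, as the rounded quantity is at least
    1.\<close>
  then have N2: "real N \<le> 2 * z powr (real r / 2)" using z1 zr by linarith
  \<comment> \<open>The factor 2 in the lower bound on \<open>t\<close> gives
    \<open>z \<le> n powr (2 / r) / 2\<close>; raised to the power \<open>r / 2 \<ge> 1\<close> it
    still saves a factor 2, which pays for the rounding.\<close>
  have "z \<le> A * real n ^ 2 / (2 * A * real n powr (2 - 2 / real r))"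
    unfolding z_def using t(1) A n t0 by (intro divide_left_mono) auto
  also have "\<dots> = real n powr (2 / real r) / 2"
    using A n by (simp add: powr_diff field_simps)
  finally have "z powr (real r / 2) \<le> (real n powr (2 / real r) / 2) powr (real r / 2)"
    using z1 by (intro powr_mono2) auto
  also have "\<dots> = real n * (1 / 2) powr (real r / 2)"
    using n r powr_mult[of "real n powr (2 / real r)" "1 / 2" "real r / 2"] by (simp add: powr_powr)
  also have "\<dots> \<le> real n * (1 / 2) powr 1"
    using r by (intro mult_left_mono powr_mono') auto
  finally have "2 * z powr (real r / 2) \<le> n" by simp
  then show "N \<le> n" using N2 by simp
  have "z = (z powr (real r / 2)) powr (2 / real r)" using z1 r by (simp add: powr_powr)
  also have "\<dots> \<le> N powr (2 / real r)" using Nz z1 by (intro powr_mono2) auto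
  finally have "real N powr (- 2 / r) \<le> 1 / z"
    using z1 by (simp add: powr_minus divide_simps)
  then have "A * real N powr (- 2 / r) * E \<le> A * (1 / z) * (real n ^ 2 / 2)"
    using A E1 z1 by (intro mult_mono) (auto simp: E_def)
  also have "\<dots> = t / 2" using t0 n A by (simp add: z_def field_simps)
  finally show "A * real N powr (- 2 / r) * card (nsets {1..n} 2) \<le> t / 2" by (simp add: E_def)
  have "real t \<le> E" using t(2) E2 by simp
  then show "t \<le> card (nsets {1..n} 2)" by (simp add: E_def)
  have "card (local_sets N {1..n} 2) \<le> card {1..n} * N ^ (2 - 1)"
    by (rule card_local_sets_le) (use N0 in auto)
  then have D: "real (card (local_sets N {1..n} 2)) \<le> n * N" by (simp flip: of_nat_mult)
  have npowr: "(real n ^ 2) powr s = real n ^ k" if s: "2 * s = real k" for s k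
  proof -
    have "(real n ^ 2) powr s = (real n powr 2) powr s" using n by simp
    also have "\<dots> = real n powr (2 * s)" by (rule powr_powr)
    also have "\<dots> = real n ^ k" unfolding s using n by (intro powr_realpow) simp
    finally show ?thesis .
  qed
  have zpowr: "z powr (real r / 2) = A powr (real r / 2) * (real n ^ 2 / real t) powr (real r / 2)"
    unfolding zq by (rule powr_mult)
  have arrange: "4 * u * (2 * (a * q)) = 8 * a * (u * q)" for u a q :: real by simp
  have "real t * card (local_sets N {1..n} 2) / E \<le> real t * (n * N) / (real n ^ 2 / 4)"
    using D E2 n by (intro frac_le mult_left_mono) auto
  also have "\<dots> = 4 * (real t / n) * N" using n by (simp add: power2_eq_square field_simps)
  also have "\<dots> \<le> 4 * (real t / n) * (2 * z powr (real r / 2))"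
    using N2 by (intro mult_left_mono) auto
  also have "\<dots> = 8 * A powr (real r / 2) * ((real t / n) * (real n ^ 2 / real t) powr (real r / 2))"
    unfolding zpowr by (rule arrange)
  also have "(real t / n) * (real n ^ 2 / real t) powr (real r / 2) = x"
  proof -
    have "(real n ^ 2 / real t) powr (real r / 2) = real n ^ r / real t powr (real r / 2)"
      unfolding powr_divide by (subst npowr[of _ r]) auto
    also have "real t powr (real r / 2) = real t * real t powr (real r / 2 - 1)"
      using t0 by (simp add: powr_diff)
    also have "real n ^ r = real n * real n ^ (r - 1)" using r by (simp add: power_eq_if)
    finally have "(real n ^ 2 / real t) powr (real r / 2) = real n / real t * x"
      by (simp add: x_def)
    then show ?thesis using t0 n by simp
  qed
  finally show "real t * card (local_sets N {1..n} 2) / card (nsets {1..n} 2) \<le> 8 * A powr (real r / 2) * x"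
    by (simp add: E_def)
  have "real t powr (real r / 2 - 1) \<le> (real n ^ 2) powr (real r / 2 - 1)"
    using tn r by (intro powr_mono2) (simp_all del: of_nat_power)
  also have "\<dots> = real n ^ (r - 2)"
    using r by (intro npowr) (simp add: of_nat_diff)
  finally have "real n * real t powr (real r / 2 - 1) \<le> real n * real n ^ (r - 2)"
    by (intro mult_left_mono) auto
  also have "\<dots> = real n ^ (r - 1)"
  proof -
    have "r - 1 = Suc (r - 2)" using r by simp
    then show ?thesis by (simp only: power_Suc)
  qed
  finally show "real n \<le> x" using t0 by (simp add: x_def field_simps)
qed

section \<open>Choice of the constants and the budget, and passage to the limit\<close>

theorem theorem1p4:
  fixes r :: nat and \<alpha> :: real
  assumes "r \<ge> 2" and "0 < \<alpha>" and "\<alpha> < 1"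
  shows "\<forall>\<delta>::real. \<delta> > 0 \<longrightarrow> (\<exists>K::real. K > 0 \<and>
    (\<forall>t :: nat \<Rightarrow> nat.
      (\<forall>\<^sub>F n in sequentially.
         K * real n powr (2 - 2 / real r) \<le> real (t n) \<and>
         real (t n) \<le> real n powr (2 - \<delta>)) \<longrightarrow>
      (\<exists>b :: nat \<Rightarrow> nat.
         (\<lambda>n. real (b n)) \<in> O(\<lambda>n. real n ^ (r - 1) / real (t n) powr (real r / 2 - 1)) \<and>
         (\<exists>\<sigma> :: nat \<Rightarrow> strategy.
            (\<forall>n. is_strategy n (t n) (b n) (\<sigma> n)) \<and>
            successful t \<sigma> (has_factor \<alpha> (complete_ugraph r))))))"
proof (intro allI impI)
  fix \<delta> :: real assume \<delta>: "\<delta> > 0"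
  obtain A where A: "1 \<le> A" and "\<forall>\<^sub>F N in sequentially. A * N powr (- 2 / r) \<le> 1 \<and>
    (\<forall>n\<ge>N. bexp (A * N powr (- 2 / r)) (nsets {1..n} 2)
       (\<lambda>F. of_bool (\<not> clique_dense N n r (1 - \<alpha>) F)) \<le> exp (- real n))"
    using exists_clique_dense_constants[OF assms(1), of "1 - \<alpha>"] assms(3) by auto
  then obtain N0 :: nat where N0: "\<And>N :: nat. N0 \<le> N \<Longrightarrow> A * N powr (- 2 / r) \<le> 1"
    "\<And>N n :: nat. N0 \<le> N \<Longrightarrow> N \<le> n \<Longrightarrow> bexp (A * N powr (- 2 / r)) (nsets {1..n} 2)
       (\<lambda>F. of_bool (\<not> clique_dense N n r (1 - \<alpha>) F)) \<le> exp (- real n)"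
    unfolding eventually_sequentially by blast
  show "\<exists>K::real. K > 0 \<and>
    (\<forall>t :: nat \<Rightarrow> nat.
      (\<forall>\<^sub>F n in sequentially.
         K * real n powr (2 - 2 / real r) \<le> real (t n) \<and>
         real (t n) \<le> real n powr (2 - \<delta>)) \<longrightarrow>
      (\<exists>b :: nat \<Rightarrow> nat.
         (\<lambda>n. real (b n)) \<in> O(\<lambda>n. real n ^ (r - 1) / real (t n) powr (real r / 2 - 1)) \<and>
         (\<exists>\<sigma> :: nat \<Rightarrow> strategy.
            (\<forall>n. is_strategy n (t n) (b n) (\<sigma> n)) \<and>
            successful t \<sigma> (has_factor \<alpha> (complete_ugraph r)))))"
  proof (intro exI[of _ "2 * A"] conjI allI impI)
    fix t :: "nat \<Rightarrow> nat"
    assume t: "\<forall>\<^sub>F n in sequentially. 2 * A * real n powr (2 - 2 / real r) \<le> real (t n) \<and>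
      real (t n) \<le> real n powr (2 - \<delta>)"
    define x where "x n = real n ^ (r - 1) / real (t n) powr (real r / 2 - 1)" for n
    define C where "C = 32 * A powr (real r / 2)"
    define b where "b n = nat \<lfloor>C * x n\<rfloor>" for n
    define N where "N n = block_length A r n (t n)" for n
    define \<sigma> where "\<sigma> n = greedy_strategy (b n) (local_sets (N n) {1..n} 2)" for n
    let ?P = "\<lambda>n. measure_pmf.prob (builder_graph n (t n) (\<sigma> n)) {G. has_factor \<alpha> (complete_ugraph r) G}"
    have a: "1 \<le> A powr (real r / 2)" using A assms(1) by (intro ge_one_powr_ge_zero) auto
    have x0: "0 \<le> x n" for n by (simp add: x_def)
    have b: "real (b n) \<le> C * x n" "C * x n < real (b n) + 1" for n
      using x0[of n] a by (auto simp: b_def C_def of_nat_nat)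
    \<comment> \<open>The 4 yields \<open>4 * t n \<le> n ^ 2\<close>; the \<open>N0\<close> yields
      \<open>N0 \<le> n ^ 2 / t n \<le> N n\<close>. Here the upper bound on \<open>t\<close>
      enters.\<close>
    have "\<forall>\<^sub>F n in sequentially. max 4 (real N0) \<le> real n powr \<delta>"
    proof -
      let ?c = "max 4 (real N0)"
      have "\<forall>\<^sub>F n in sequentially. ?c powr (1 / \<delta>) \<le> real n"
        using filterlim_real_sequentially unfolding filterlim_at_top by blast
      then show ?thesis
      proof eventually_elim
        case (elim n)
        then have "(?c powr (1 / \<delta>)) powr \<delta> \<le> real n powr \<delta>"
          using \<delta> by (intro powr_mono2) auto
        then show ?case using \<delta> by (simp add: powr_powr)
      qed
    qed
    moreover have "\<forall>\<^sub>F n in sequentially. 2 \<le> (n :: nat)" by (rule eventually_ge_at_top)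
    \<comment> \<open>Missing cliques account for \<open>2 * exp (- n)\<close>, an exceeded budget
      for \<open>exp (- n)\<close>.\<close>
    ultimately have lower: "\<forall>\<^sub>F n in sequentially. 1 - 3 * exp (- real n) \<le> ?P n"
      using t
    proof eventually_elim
      case (elim n)
      have "real (t n) * (real n powr \<delta>) \<le> real n powr (2 - \<delta>) * real n powr \<delta>"
        using elim(3) by (intro mult_right_mono) auto
      also have "\<dots> = real n ^ 2" using elim(2) by (simp flip: powr_add)
      finally have tn: "real (t n) * (real n powr \<delta>) \<le> real n ^ 2" .
      have "real (t n) * 4 \<le> real (t n) * real n powr \<delta>"
        using elim(1) by (intro mult_left_mono) auto
      then have t4: "4 * real (t n) \<le> real n ^ 2" using tn by simp
      note bd = block_length_bounds[OF assms(1) A elim(2) conjunct1[OF elim(3)] t4, folded N_def x_def]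
      have "real N0 \<le> real n ^ 2 / real (t n)"
        using tn bd(1) elim(1) by (simp add: pos_le_divide_eq) (metis mult.commute mult_left_mono of_nat_0_le_iff order_trans)
      then have NN: "N0 \<le> N n" using bd(2) by simp
      let ?p = "A * real (N n) powr (- 2 / r)"
      let ?y = "C * x n"
      have "1 - (2 * bexp ?p (nsets {1..n} 2) (\<lambda>F. of_bool (\<not> clique_dense (N n) n r (1 - \<alpha>) F))
        + 2 powr (- ?y) * exp (real (t n) * card (local_sets (N n) {1..n} 2) / card (nsets {1..n} 2))) \<le> ?P n"
        unfolding \<sigma>_def
        by (rule prob_greedy_strategy_ge) (use bd N0(1)[OF NN] A assms(1) b in auto)
      moreover have "bexp ?p (nsets {1..n} 2) (\<lambda>F. of_bool (\<not> clique_dense (N n) n r (1 - \<alpha>) F)) \<le> exp (- real n)"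
        by (rule N0(2)[OF NN bd(4)])
      moreover have "2 powr (- ?y) * exp (real (t n) * card (local_sets (N n) {1..n} 2) / card (nsets {1..n} 2)) \<le> exp (- real n)"
      proof -
        have "1 / 2 \<le> ln (2 :: real)" using exp_half_le2 by (simp only: ln_ge_iff zero_less_numeral)
        then have "?y * (1 / 2) \<le> ?y * ln 2" using x0[of n] a by (intro mult_left_mono) (auto simp: C_def)
        then have "2 powr (- ?y) \<le> exp (- (?y / 2))" by (simp add: powr_def)
        then have "2 powr (- ?y) * exp (real (t n) * card (local_sets (N n) {1..n} 2) / card (nsets {1..n} 2))
          \<le> exp (- (?y / 2)) * exp (8 * A powr (real r / 2) * x n)"
          using bd(7) by (intro mult_mono) auto
        also have "\<dots> = exp (- (8 * (A powr (real r / 2) * x n)))"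
          by (simp add: C_def flip: exp_add)
        also have "\<dots> \<le> exp (- real n)"
          using bd(8) mult_right_mono[OF a x0[of n]] x0[of n] by simp
        finally show ?thesis .
      qed
      ultimately show ?case by linarith
    qed
    have "?P \<longlonglongrightarrow> 1"
    proof (rule tendsto_sandwich[OF lower _ _ tendsto_const])
      have "(\<lambda>n. exp (- real n)) \<longlonglongrightarrow> 0"
        by (intro filterlim_compose[OF exp_at_bot] filterlim_compose[OF filterlim_uminus_at_bot_at_top] filterlim_real_sequentially)
      then have "(\<lambda>n. 1 - 3 * exp (- real n)) \<longlonglongrightarrow> 1 - 3 * 0" by (intro tendsto_intros)
      then show "(\<lambda>n. 1 - 3 * exp (- real n)) \<longlonglongrightarrow> 1" by simp
    qed simp
    moreover have "is_strategy n (t n) (b n) (\<sigma> n)" for n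
      unfolding \<sigma>_def by (rule is_strategy_greedy_strategy)
    moreover have "(\<lambda>n. real (b n)) \<in> O(\<lambda>n. real n ^ (r - 1) / real (t n) powr (real r / 2 - 1))"
    proof (rule bigoI, intro always_eventually allI)
      fix n
      \<comment> \<open>This holds for every \<open>n\<close>: if \<open>t n = 0\<close>, then
        \<open>0 powr s = 0\<close> and division by zero make \<open>x n\<close>, hence
        \<open>b n\<close>, equal to 0.\<close>
      have "real (b n) \<le> C * norm (x n)" using b(1)[of n] x0[of n] by (simp only: real_norm_def abs_of_nonneg)
      then show "norm (real (b n)) \<le> C * norm (real n ^ (r - 1) / real (t n) powr (real r / 2 - 1))"
        unfolding x_def by (simp only: real_norm_def abs_of_nat)
    qed
    ultimately show "\<exists>b. (\<lambda>n. real (b n)) \<in> O(\<lambda>n. real n ^ (r - 1) / real (t n) powr (real r / 2 - 1)) \<and>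
      (\<exists>\<sigma>. (\<forall>n. is_strategy n (t n) (b n) (\<sigma> n)) \<and> successful t \<sigma> (has_factor \<alpha> (complete_ugraph r)))"
      unfolding successful_def by blast
  qed (use A in simp)
qed

end
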